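(* Let $c>0$ and $\Delta=(0,c]$. Let $0<\lambda<1$, $a>0$, and let $G$ be a probability distribution on $\mathbb R$. Define the compound negative binomial distribution $$F_a:=\sum_{n=0}^\infty\binom{a+n-1}{a-1}(1-\lambda)^a\lambda^n\,G^{*n}.$$ Then the following are equivalent: (i) $F_a\in\mathcal S_\Delta\cap\mathcal D_\Delta$; (ii) $G\in\mathcal S_\Delta\cap\mathcal D_\Delta$; (iii) $G\in\mathcal L_\Delta\cap\mathcal D_\Delta$ and $F_a(x+\Delta)\sim\frac{a\lambda}{1-\lambda}\,G(x+\Delta)$. If additionally $G$ is a distribution on $\mathbb R_+=[0,\infty)$, then the following are equivalent: (i) $F_a\in\mathcal S_\Delta$; (ii) $G\in\mathcal S_\Delta$; (iii) $G\in\mathcal L_\Delta$ and $F_a(x+\Delta)\sim\frac{a\lambda}{1-\lambda}\,G(x+\Delta)$.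
   Context: $\binom{a+n-1}{a-1}=\Gamma(a+n)/(\Gamma(a)\,n!)$ for real $a>0$. $G^{*n}$ is the $n$-fold convolution of $G$, with $G^{*0}$ the Dirac measure at $0$. For $\Delta=(0,c]$ and a distribution $F$ on $\mathbb R$, $F(x+\Delta):=F((x,x+c])$. $\alpha(x)\sim\beta(x)$ means $\alpha(x)/\beta(x)\to1$ as $x\to\infty$. A non-negative measurable function $\alpha$ belongs to $\mathcal L$ if there is $x_0>0$ with $\alpha(x)>0$ for $x\ge x_0$ and, for every fixed $y>0$, $\alpha(x+y)\sim\alpha(x)$. $F\in\mathcal L_\Delta$ if the function $x\mapsto F(x+\Delta)$ is in $\mathcal L$. $F\in\mathcal S_\Delta$ if $F\in\mathcal L_\Delta$ and $F^{*2}(x+\Delta)\sim 2F(x+\Delta)$. A function $\alpha:\mathbb R\to\mathbb R_+$ is almost decreasing if there exist $x_0>0$ and $K>0$ such that $\alpha(x+y)\le K\alpha(x)$ for all $x>x_0$, $y>0$. $F\in\mathcal D_\Delta$ if $x\mapsto F(x+\Delta)$ is almost decreasing. *)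

theory Defs
  imports "HOL-Probability.Probability"
begin

primrec conv_power :: "real measure \<Rightarrow> nat \<Rightarrow> real measure" where
  "conv_power G 0 = return borel 0"
| "conv_power G (Suc n) = (G \<star> conv_power G n)"

text \<open>
  The Gamma quotient is the binomial coefficient of \<open>a + n - 1\<close> over \<open>a - 1\<close>, for real \<open>a > 0\<close>;
  \<open>q\<close> is the parameter written as lambda in the literature.
\<close>

definition neg_binomial_weight :: "real \<Rightarrow> real \<Rightarrow> nat \<Rightarrow> real" where
  "neg_binomial_weight a q n =
     Gamma (a + real n) / (Gamma a * fact n) * (1 - q) powr a * q ^ n"

definition compound_neg_binomial :: "real \<Rightarrow> real \<Rightarrow> real measure \<Rightarrow> real measure" where
  "compound_neg_binomial a q G =
     measure_of UNIV (sets borel)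
       (\<lambda>A. \<Sum>n. ennreal (neg_binomial_weight a q n) * emeasure (conv_power G n) A)"

text \<open>The value \<open>F(x + \<Delta>)\<close> for \<open>\<Delta> = (0,c]\<close>.\<close>

definition local_prob :: "real \<Rightarrow> real measure \<Rightarrow> real \<Rightarrow> real" where
  "local_prob c F x = measure F {x<..x + c}"

text \<open>
  The library relation \<open>f \<sim>[at_top] g\<close> asks that the quotient tend to \<open>1\<close>, with \<open>0 / 0\<close> read
  as \<open>1\<close>. That convention plays no role below: the right-hand side is always eventually
  positive, by membership in \<open>class_L\<close> or \<open>class_L_Delta\<close>.
\<close>

definition class_L :: "(real \<Rightarrow> real) set" where
  "class_L = {f. f \<in> borel_measurable borel \<and> (\<forall>x. 0 \<le> f x) \<and>
                 (\<exists>x0>0. \<forall>x\<ge>x0. 0 < f x) \<and>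
                 (\<forall>y>0. (\<lambda>x. f (x + y)) \<sim>[at_top] f)}"

definition almost_decreasing :: "(real \<Rightarrow> real) \<Rightarrow> bool" where
  "almost_decreasing f \<longleftrightarrow>
     (\<forall>x. 0 \<le> f x) \<and> (\<exists>x0>0. \<exists>K>0. \<forall>x>x0. \<forall>y>0. f (x + y) \<le> K * f x)"

definition class_L_Delta :: "real \<Rightarrow> real measure set" where
  "class_L_Delta c = {F. real_distribution F \<and> local_prob c F \<in> class_L}"

definition class_S_Delta :: "real \<Rightarrow> real measure set" where
  "class_S_Delta c = {F. F \<in> class_L_Delta c \<and>
     local_prob c (conv_power F 2) \<sim>[at_top] (\<lambda>x. 2 * local_prob c F x)}"

definition class_D_Delta :: "real \<Rightarrow> real measure set" where
  "class_D_Delta c = {F. real_distribution F \<and> almost_decreasing (local_prob c F)}"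

lemma real_distribution_convolution:
  assumes "real_distribution M" "real_distribution N"
  shows "real_distribution (M \<star> N)"
proof -
  interpret M: real_distribution M by fact
  interpret N: real_distribution N by fact
  interpret P: pair_prob_space M N ..
  have "prob_space (distr (M \<Otimes>\<^sub>M N) borel (\<lambda>(x, y). x + y))"
    by (rule P.prob_space_distr) measurable
  then show ?thesis
    by (simp add: real_distribution_def real_distribution_axioms_def convolution_def)
qed

lemma real_distribution_conv_power:
  assumes "real_distribution G"
  shows "real_distribution (conv_power G n)"
proof (induction n)
  case 0
  then show ?case
    by (simp add: real_distribution_def real_distribution_axioms_def prob_space_return)
qed (simp add: real_distribution_convolution assms)

lemma conv_power_1:
  assumes "real_distribution G"
  shows "conv_power G 1 = G"
proof (rule measure_eqI)
  interpret real_distribution G by fact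
  have R: "finite_measure (return borel (0::real))"
    by (simp add: prob_space_return prob_space.finite_measure)
  show "sets (conv_power G 1) = sets G" by simp
  fix A assume "A \<in> sets (conv_power G 1)"
  then have A: "A \<in> sets borel" by simp
  have "emeasure (G \<star> return borel 0) A =
      (\<integral>\<^sup>+x. \<integral>\<^sup>+y. indicator A (x + y) \<partial>return borel 0 \<partial>G)"
    by (rule convolution_emeasure') (auto simp: A R finite_measure_axioms)
  also have "\<dots> = (\<integral>\<^sup>+x. indicator A x \<partial>G)"
    using A by (intro nn_integral_cong) (subst nn_integral_return, auto)
  finally show "emeasure (conv_power G 1) A = emeasure G A"
    using A by simp
qed

lemma conv_power_2:
  assumes "real_distribution G"
  shows "conv_power G 2 = (G \<star> G)"
  using conv_power_1[OF assms] by (simp add: numeral_2_eq_2)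

lemma neg_binomial_weight_nonneg:
  assumes "0 < a" "0 < q" "q < 1"
  shows "0 \<le> neg_binomial_weight a q n"
  unfolding neg_binomial_weight_def using assms
  by (intro mult_nonneg_nonneg divide_nonneg_nonneg) (auto simp: less_imp_le Gamma_real_pos)

lemma neg_binomial_weight_sums:
  assumes "0 < a" "0 < q" "q < 1"
  shows "neg_binomial_weight a q sums 1"
proof -
  have na: "a \<notin> \<int>\<^sub>\<le>\<^sub>0"
    using assms by (auto elim!: nonpos_Ints_cases)
  have "(\<lambda>n. ((-a) gchoose n) * (-q) ^ n) sums (1 + (-q)) powr (-a)"
    by (rule gen_binomial_real) (use assms in auto)
  then have "(\<lambda>n. (1 - q) powr a * (((-a) gchoose n) * (-q) ^ n)) sums
      ((1 - q) powr a * (1 - q) powr (-a))"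
    by (intro sums_mult) simp
  moreover have "(1 - q) powr a * (((-a) gchoose n) * (-q) ^ n) = neg_binomial_weight a q n" for n
  proof -
    have "(- 1) ^ n * (-q) ^ n = q ^ n"
      using power_mult_distrib[of "- 1" "-q" n] by simp
    then have "((-a) gchoose n) * (-q) ^ n = pochhammer a n / fact n * q ^ n"
      using gbinomial_pochhammer[of "-a" n] by (simp add: mult_ac)
    then show ?thesis
      unfolding neg_binomial_weight_def pochhammer_Gamma[OF na, of n] by (simp add: mult_ac)
  qed
  moreover have "(1 - q) powr a * (1 - q) powr (-a) = 1"
    using assms by (simp flip: powr_add)
  ultimately show ?thesis by simp
qed

lemma emeasure_compound_neg_binomial:
  assumes G: "real_distribution G" and A: "A \<in> sets borel"
  shows "emeasure (compound_neg_binomial a q G) A =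
    (\<Sum>n. ennreal (neg_binomial_weight a q n) * emeasure (conv_power G n) A)"
proof (rule emeasure_measure_of[OF compound_neg_binomial_def])
  let ?m = "\<lambda>A. \<Sum>n. ennreal (neg_binomial_weight a q n) * emeasure (conv_power G n) A"
  have S: "sets (conv_power G n) = sets borel" for n
    using real_distribution.events_eq_borel[OF real_distribution_conv_power[OF G]] .
  have sb: "sets (compound_neg_binomial a q G) = sets borel"
    unfolding compound_neg_binomial_def using sets.sigma_sets_eq[of borel] by simp
  show "A \<in> sets (compound_neg_binomial a q G)"
    using A sb by simp
  show "positive (sets (compound_neg_binomial a q G)) ?m"
    by (simp add: positive_def)
  show "countably_additive (sets (compound_neg_binomial a q G)) ?m"
    unfolding sb
  proof (rule countably_additiveI)
    fix B :: "nat \<Rightarrow> real set"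
    assume B: "range B \<subseteq> sets borel" "disjoint_family B"
    have "(\<Sum>i. ?m (B i)) =
        (\<Sum>n. \<Sum>i. ennreal (neg_binomial_weight a q n) * emeasure (conv_power G n) (B i))"
      using nn_integral_suminf[of "\<lambda>i n. ennreal (neg_binomial_weight a q n) *
          emeasure (conv_power G n) (B i)" "count_space UNIV"]
      by (simp add: nn_integral_count_space_nat)
    also have "\<dots> = ?m (\<Union> (range B))"
      using B by (simp add: ennreal_suminf_cmult suminf_emeasure S)
    finally show "(\<Sum>i. ?m (B i)) = ?m (\<Union> (range B))" .
  qed
qed auto

lemma real_distribution_compound_neg_binomial:
  assumes G: "real_distribution G" and "0 < a" "0 < q" "q < 1"
  shows "real_distribution (compound_neg_binomial a q G)"
proof -
  have sb: "sets (compound_neg_binomial a q G) = sets borel"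
    unfolding compound_neg_binomial_def using sets.sigma_sets_eq[of borel] by simp
  have 1: "emeasure (conv_power G n) UNIV = 1" for n
    using prob_space.emeasure_space_1[OF real_distribution.axioms(1)[OF real_distribution_conv_power[OF G]]]
      real_distribution.space_eq_univ[OF real_distribution_conv_power[OF G]] by metis
  have "emeasure (compound_neg_binomial a q G) UNIV = (\<Sum>n. ennreal (neg_binomial_weight a q n))"
    by (simp add: emeasure_compound_neg_binomial[OF G] 1)
  also have "\<dots> = ennreal 1"
    by (rule suminf_ennreal_eq) (use assms neg_binomial_weight_nonneg neg_binomial_weight_sums in auto)
  finally have "prob_space (compound_neg_binomial a q G)"
    using sets_eq_imp_space_eq[OF sb] by (intro prob_spaceI) simp
  then show ?thesis
    using sb by (simp add: real_distribution_def real_distribution_axioms_def)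
qed

end

theory Submission
  imports Defs
begin

text \<open>
  Write \<open>g x\<close> for \<open>G(x + \<Delta>)\<close> and \<open>f x\<close> for the local probability of the compound distribution
  \<open>F\<close> with parameter \<open>a\<close>, and let \<open>\<mu> = a q / (1 - q)\<close> be the mean of the weights.
  The principle is that a large sum of \<open>n\<close> independent subexponential terms is due to a single large
  term, so that \<open>conv_power G n\<close> has local probability about \<open>n * g x\<close> and \<open>f x\<close> is about \<open>\<mu> * g x\<close>.
  Since the compound distributions form a convolution semigroup in \<open>a\<close> (\<open>compound_convolution\<close>),
  \<open>F \<star> F\<close> is the compound distribution with parameter \<open>2 a\<close>, whose weights have mean \<open>2 \<mu>\<close>.

  From \<open>G\<close> to \<open>F\<close>: Kesten's bound (\<open>kesten_bound\<close>) dominates the series for \<open>f x / g x\<close>, its terms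
  converge by \<open>conv_power_ratio\<close>, and so \<open>f\<close> is asymptotic to \<open>\<mu> * g\<close>. The same statement for \<open>2 a\<close>
  then shows that \<open>F\<close> is subexponential. Summands that are very negative must not raise
  the local probability much; this is what almost decreasing local probabilities, or the absence of
  negative summands, are for.

  From the asymptotics to \<open>G\<close>: for long-tailed \<open>g\<close> the lower bound \<open>n * g x\<close> always holds
  asymptotically (\<open>conv_power_liminf\<close>). If the weighted sum of these bounds is attained, each single
  one is, in particular the one for \<open>n = 2\<close>.

  From \<open>F\<close> to \<open>G\<close>: here \<open>g\<close> is only known to be at most a multiple of \<open>f\<close>. Still, for measures
  dominated by the subexponential \<open>F\<close>, taking local probabilities relative to \<open>f\<close> is asymptotically a
  derivation on the convolution algebra (\<open>convolution_derivation\<close>). Applied to the power series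
  for \<open>F\<close>, with \<open>r = g / f\<close>, it yields a chain rule: \<open>\<mu>\<close> times the convolution of \<open>r\<close> with the
  compound distribution of parameter \<open>a + 1\<close> tends to \<open>1\<close>. The remainder of the series is
  negligible because the weights for \<open>a\<close> are of smaller order than those for \<open>2 a\<close>, and \<open>F \<star> F\<close> has
  local probability about \<open>2 * f x\<close>. As convolution with a compound negative binomial distribution can
  be inverted (\<open>compound_tauberian\<close>), \<open>r\<close> itself tends to \<open>1 / \<mu>\<close>, and one more application of the
  product rule, to \<open>G \<star> G\<close>, shows that \<open>G\<close> is subexponential.
\<close>

section \<open>Convolution of a function with a distribution\<close>

lemma real_distribution_facts:
  assumes "real_distribution M"
  shows "finite_measure M" "prob_space M" "sigma_finite_measure M" "sets M = sets borel"
    "space M = UNIV" "measure M UNIV = 1"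
proof -
  interpret real_distribution M by fact
  show "finite_measure M" "prob_space M" "sigma_finite_measure M" "sets M = sets borel"
    "space M = UNIV" by unfold_locales simp_all
  show "measure M UNIV = 1" using prob_space by simp
qed

text \<open>\<open>smear M h\<close> is the convolution of the function \<open>h\<close> with the measure \<open>M\<close>. Ratios of local
  probabilities are functions and not measures, so both kinds of convolution are needed.\<close>

definition smear :: "real measure \<Rightarrow> (real \<Rightarrow> real) \<Rightarrow> real \<Rightarrow> real" where
  "smear M h x = (\<integral>s. h (x - s) \<partial>M)"

lemma integrable_translate_bounded:
  fixes h :: "real \<Rightarrow> real"
  assumes M: "real_distribution M" and [measurable]: "h \<in> borel_measurable borel"
    and "\<And>x. \<bar>h x\<bar> \<le> C"
  shows "integrable M (\<lambda>s. h (x - s))"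
proof -
  interpret real_distribution M by fact
  show ?thesis
    by (rule integrable_const_bound[where B = C]) (use assms in auto)
qed

lemma smear_measurable [measurable]:
  assumes M: "real_distribution M" and [measurable]: "h \<in> borel_measurable borel"
  shows "smear M h \<in> borel_measurable borel"
proof -
  interpret real_distribution M by fact
  have "(\<lambda>x. \<integral>s. h (x - s) \<partial>M) \<in> borel_measurable borel"
    by (rule borel_measurable_lebesgue_integral) measurable
  then show ?thesis
    by (simp add: smear_def [abs_def])
qed

lemma smear_bounded:
  assumes M: "real_distribution M" and h: "h \<in> borel_measurable borel"
    and b: "\<And>x. \<bar>h x\<bar> \<le> C"
  shows "\<bar>smear M h x\<bar> \<le> C"
proof -
  interpret real_distribution M by fact
  have "\<bar>smear M h x\<bar> \<le> (\<integral>s. \<bar>h (x - s)\<bar> \<partial>M)"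
    unfolding smear_def by (rule integral_abs_bound)
  also have "\<dots> \<le> (\<integral>s. C \<partial>M)"
    using integrable_translate_bounded[OF M h b] b by (intro integral_mono) auto
  finally show ?thesis using prob_space by simp
qed

lemma smear_smear:
  assumes M: "real_distribution M" and N: "real_distribution N"
    and [measurable]: "h \<in> borel_measurable borel" and b: "\<And>x. \<bar>h x\<bar> \<le> C"
  shows "smear N (smear M h) x = smear (M \<star> N) h x"
proof -
  interpret M: real_distribution M by fact
  interpret N: real_distribution N by fact
  interpret P: pair_prob_space M N ..
  have "smear (M \<star> N) h x = (\<integral>p. h (x - (fst p + snd p)) \<partial>(M \<Otimes>\<^sub>M N))"
    unfolding smear_def convolution_def by (subst integral_distr) (auto simp: case_prod_beta)
  also have "\<dots> = (\<integral>t. (\<integral>s. h (x - (s + t)) \<partial>M) \<partial>N)"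
  proof -
    have "integrable (M \<Otimes>\<^sub>M N) (\<lambda>p. h (x - (fst p + snd p)))"
      by (rule P.integrable_const_bound[where B = C]) (use b in auto)
    then show ?thesis
      using P.integral_snd[of "\<lambda>s t. h (x - (s + t))"] by (simp add: case_prod_beta')
  qed
  also have "\<dots> = smear N (smear M h) x"
    unfolding smear_def by (simp add: algebra_simps)
  finally show ?thesis ..
qed

lemma smear_tendsto:
  assumes M: "real_distribution M" and [measurable]: "h \<in> borel_measurable borel"
    and b: "\<And>x. \<bar>h x\<bar> \<le> C" and lim: "(h \<longlongrightarrow> l) at_top"
  shows "(smear M h \<longlongrightarrow> l) at_top"
proof -
  interpret real_distribution M by fact
  have "((\<lambda>x. \<integral>s. h (x - s) \<partial>M) \<longlongrightarrow> (\<integral>s. l \<partial>M)) at_top"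
  proof (rule integral_dominated_convergence_at_top[where w = "\<lambda>_. C"])
    show "AE s in M. ((\<lambda>x. h (x - s)) \<longlongrightarrow> l) at_top"
    proof (rule AE_I2)
      fix s :: real
      have "filterlim (\<lambda>x. x - s) at_top at_top"
        using filterlim_tendsto_add_at_top[OF tendsto_const[of "-s"] filterlim_ident]
        by (simp add: algebra_simps)
      then show "((\<lambda>x. h (x - s)) \<longlongrightarrow> l) at_top"
        by (rule filterlim_compose[OF lim])
    qed
  qed (use b in auto)
  then show ?thesis
    using prob_space by (simp add: smear_def [abs_def])
qed

section \<open>Local probabilities of a convolution\<close>

lemma local_prob_bounds:
  assumes "real_distribution M"
  shows "0 \<le> local_prob c M x" "local_prob c M x \<le> 1" "\<bar>local_prob c M x\<bar> \<le> 1"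
  using prob_space.prob_le_1[OF real_distribution_facts(2)[OF assms]]
  by (simp_all add: local_prob_def)

text \<open>A local probability is a difference of two values of the distribution function, which is monotone.\<close>

lemma local_prob_measurable [measurable]:
  assumes "real_distribution M" and "0 < c"
  shows "local_prob c M \<in> borel_measurable borel"
proof -
  interpret real_distribution M by fact
  have [measurable]: "cdf M \<in> borel_measurable borel"
    by (rule borel_measurable_mono) (auto simp: mono_def intro: cdf_nondecreasing)
  have "local_prob c M = (\<lambda>x. cdf M (x + c) - cdf M x)"
    using \<open>0 < c\<close> by (auto simp: local_prob_def cdf_diff_eq fun_eq_iff)
  then show ?thesis by simp
qed

text \<open>The mass that independent \<open>X\<close> and \<open>Y\<close> with laws \<open>M\<close> and \<open>N\<close> give to the event that \<open>X + Y\<close>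
  lies in \<open>x + \<Delta>\<close> while the pair lies in \<open>S\<close>. All estimates of \<open>(M \<star> N)(x + \<Delta>)\<close> below cut the
  plane into regions \<open>S\<close> that say which summand is responsible for a large sum.\<close>

definition joint_mass :: "real \<Rightarrow> real measure \<Rightarrow> real measure \<Rightarrow> (real \<times> real) set \<Rightarrow> real \<Rightarrow> real" where
  "joint_mass c M N S x =
     measure (M \<Otimes>\<^sub>M N) {p \<in> S. x < fst p + snd p \<and> fst p + snd p \<le> x + c}"

lemma sets_pair_real_distribution:
  assumes "real_distribution M" "real_distribution N"
  shows "sets (M \<Otimes>\<^sub>M N) = sets (borel \<Otimes>\<^sub>M borel)"
  using real_distribution_facts(4)[OF assms(1)] real_distribution_facts(4)[OF assms(2)]
  by (rule sets_pair_measure_cong)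

lemma joint_mass_sets:
  assumes [measurable]: "S \<in> sets (borel \<Otimes>\<^sub>M borel)"
  shows "{p \<in> S. (x::real) < fst p + snd p \<and> fst p + snd p \<le> x + c} \<in> sets (borel \<Otimes>\<^sub>M borel)"
proof -
  have "{p \<in> space (borel \<Otimes>\<^sub>M borel). p \<in> S \<and> x < fst p + snd p \<and> fst p + snd p \<le> x + c}
      \<in> sets (borel \<Otimes>\<^sub>M borel)"
    by measurable
  then show ?thesis by (simp add: space_pair_measure)
qed

lemma UNIV_sets_pair_borel [simp]: "UNIV \<in> sets (borel \<Otimes>\<^sub>M (borel :: real measure) :: (real \<times> real) measure)"
  using sets.top[of "borel \<Otimes>\<^sub>M borel :: (real \<times> real) measure"] by (simp add: space_pair_measure)

lemma finite_measure_pair_real_distribution: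
  assumes "real_distribution M" "real_distribution N"
  shows "finite_measure (M \<Otimes>\<^sub>M N)"
  by (intro finite_measure_pair_measure real_distribution_facts assms)

lemma joint_mass_mono:
  assumes "real_distribution M" "real_distribution N" and "T \<in> sets (borel \<Otimes>\<^sub>M borel)"
    and "\<And>u v. (u, v) \<in> S \<Longrightarrow> x < u + v \<Longrightarrow> u + v \<le> x + c \<Longrightarrow> (u, v) \<in> T"
  shows "joint_mass c M N S x \<le> joint_mass c M N T x"
  unfolding joint_mass_def
  by (rule finite_measure.finite_measure_mono[OF finite_measure_pair_real_distribution])
    (use assms joint_mass_sets in \<open>auto simp: sets_pair_real_distribution\<close>)

lemma joint_mass_Un_le:
  assumes MN: "real_distribution M" "real_distribution N"
    and ST: "S \<in> sets (borel \<Otimes>\<^sub>M borel)" "T \<in> sets (borel \<Otimes>\<^sub>M borel)"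
  shows "joint_mass c M N (S \<union> T) x \<le> joint_mass c M N S x + joint_mass c M N T x"
proof -
  have "{p \<in> S \<union> T. x < fst p + snd p \<and> fst p + snd p \<le> x + c} =
    {p \<in> S. x < fst p + snd p \<and> fst p + snd p \<le> x + c} \<union>
    {p \<in> T. x < fst p + snd p \<and> fst p + snd p \<le> x + c}" by auto
  then show ?thesis
    unfolding joint_mass_def
    by (simp add: measure_Un_le sets_pair_real_distribution[OF MN] joint_mass_sets ST)
qed

lemma joint_mass_Un:
  assumes MN: "real_distribution M" "real_distribution N"
    and ST: "S \<in> sets (borel \<Otimes>\<^sub>M borel)" "T \<in> sets (borel \<Otimes>\<^sub>M borel)"
    and disj: "\<And>u v. (u, v) \<in> S \<Longrightarrow> (u, v) \<in> T \<Longrightarrow> x < u + v \<Longrightarrow> False"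
  shows "joint_mass c M N (S \<union> T) x = joint_mass c M N S x + joint_mass c M N T x"
proof -
  have "{p \<in> S \<union> T. x < fst p + snd p \<and> fst p + snd p \<le> x + c} =
    {p \<in> S. x < fst p + snd p \<and> fst p + snd p \<le> x + c} \<union>
    {p \<in> T. x < fst p + snd p \<and> fst p + snd p \<le> x + c}" by auto
  moreover have "{p \<in> S. x < fst p + snd p \<and> fst p + snd p \<le> x + c} \<inter>
    {p \<in> T. x < fst p + snd p \<and> fst p + snd p \<le> x + c} = {}" using disj by auto
  ultimately show ?thesis
    unfolding joint_mass_def
    by (simp add: finite_measure.finite_measure_Union[OF finite_measure_pair_real_distribution[OF MN]]
        sets_pair_real_distribution[OF MN] joint_mass_sets ST)
qed

lemma joint_mass_UNIV:
  assumes "real_distribution M" "real_distribution N"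
  shows "joint_mass c M N UNIV x = local_prob c (M \<star> N) x"
proof -
  interpret M: real_distribution M by fact
  interpret N: real_distribution N by fact
  show ?thesis
    unfolding joint_mass_def local_prob_def convolution_def
    by (subst measure_distr) (auto intro!: arg_cong2[where f = measure] simp: space_pair_measure)
qed

lemma joint_mass_snd:
  assumes "real_distribution M" "real_distribution N" and V [measurable]: "V \<in> sets borel"
  shows "joint_mass c M N (UNIV \<times> V) x = (\<integral>s. indicator V s * local_prob c M (x - s) \<partial>N)"
proof -
  interpret M: real_distribution M by fact
  interpret N: real_distribution N by fact
  interpret P: pair_prob_space M N ..
  let ?E = "{p \<in> UNIV \<times> V. x < fst p + snd p \<and> fst p + snd p \<le> x + c}"
  have E: "?E \<in> sets (M \<Otimes>\<^sub>M N)"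
    using joint_mass_sets[of "UNIV \<times> V" x c] by (simp add: sets_pair_real_distribution[OF assms(1,2)])
  have "joint_mass c M N (UNIV \<times> V) x = (\<integral>p. indicator ?E p \<partial>(M \<Otimes>\<^sub>M N))"
    unfolding joint_mass_def using E by simp
  also have "\<dots> = (\<integral>t. (\<integral>s. indicator ?E (s, t) \<partial>M) \<partial>N)"
  proof -
    have "integrable (M \<Otimes>\<^sub>M N) (indicator ?E :: _ \<Rightarrow> real)"
      using E by (intro P.integrable_const_bound[where B = 1]) auto
    then show ?thesis
      using P.integral_snd[of "\<lambda>s t. indicat_real ?E (s, t)"] by (simp add: case_prod_beta')
  qed
  also have "\<dots> = (\<integral>t. indicator V t * local_prob c M (x - t) \<partial>N)"
  proof (rule Bochner_Integration.integral_cong[OF refl])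
    fix t
    have "(\<integral>s. indicator ?E (s, t) \<partial>M) = (\<integral>s. (indicator V t :: real) * indicator {x - t<..x - t + c} s \<partial>M)"
      by (rule Bochner_Integration.integral_cong[OF refl]) (auto simp: indicator_def algebra_simps)
    also have "\<dots> = indicator V t * local_prob c M (x - t)"
      by (simp add: local_prob_def)
    finally show "(\<integral>s. indicator ?E (s, t) \<partial>M) = indicator V t * local_prob c M (x - t)" .
  qed
  finally show ?thesis .
qed

lemma joint_mass_fst:
  assumes "real_distribution M" "real_distribution N" and U [measurable]: "U \<in> sets borel"
  shows "joint_mass c M N (U \<times> UNIV) x = (\<integral>s. indicator U s * local_prob c N (x - s) \<partial>M)"
proof -
  interpret M: real_distribution M by fact
  interpret N: real_distribution N by fact
  interpret P: pair_prob_space M N ..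
  let ?E = "{p \<in> U \<times> UNIV. x < fst p + snd p \<and> fst p + snd p \<le> x + c}"
  have E: "?E \<in> sets (M \<Otimes>\<^sub>M N)"
    using joint_mass_sets[of "U \<times> UNIV" x c] by (simp add: sets_pair_real_distribution[OF assms(1,2)])
  have "joint_mass c M N (U \<times> UNIV) x = (\<integral>p. indicator ?E p \<partial>(M \<Otimes>\<^sub>M N))"
    unfolding joint_mass_def using E by simp
  also have "\<dots> = (\<integral>s. (\<integral>t. indicator ?E (s, t) \<partial>N) \<partial>M)"
  proof -
    have "integrable (M \<Otimes>\<^sub>M N) (indicator ?E :: _ \<Rightarrow> real)"
      using E by (intro P.integrable_const_bound[where B = 1]) auto
    then show ?thesis
      using P.integral_fst'[of "indicat_real ?E"] by simp
  qed
  also have "\<dots> = (\<integral>s. indicator U s * local_prob c N (x - s) \<partial>M)"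
  proof (rule Bochner_Integration.integral_cong[OF refl])
    fix s
    have "(\<integral>t. indicator ?E (s, t) \<partial>N) = (\<integral>t. (indicator U s :: real) * indicator {x - s<..x - s + c} t \<partial>N)"
      by (rule Bochner_Integration.integral_cong[OF refl]) (auto simp: indicator_def algebra_simps)
    also have "\<dots> = indicator U s * local_prob c N (x - s)"
      by (simp add: local_prob_def)
    finally show "(\<integral>t. indicator ?E (s, t) \<partial>N) = indicator U s * local_prob c N (x - s)" .
  qed
  finally show ?thesis .
qed

section \<open>The semigroup of compound negative binomial distributions\<close>

lemma return_0_convolution:
  assumes M: "real_distribution M"
  shows "(return borel 0 \<star> M) = M"
proof (rule measure_eqI)
  note [simp] = real_distribution_facts[OF M]
  have R: "finite_measure (return borel (0::real))"
    by (simp add: prob_space_return prob_space.finite_measure)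
  show "sets (return borel 0 \<star> M) = sets M" by simp
  fix A assume "A \<in> sets (return borel 0 \<star> M)"
  then have A: "A \<in> sets borel" by simp
  have "emeasure (return borel 0 \<star> M) A =
      (\<integral>\<^sup>+x. \<integral>\<^sup>+y. indicator A (x + y) \<partial>M \<partial>return borel 0)"
    by (rule convolution_emeasure') (auto simp: A R)
  also have "\<dots> = (\<integral>\<^sup>+y. indicator A (0 + y) \<partial>M)"
  proof -
    have [measurable_cong]: "sets M = sets borel" by simp
    have [measurable]: "A \<in> sets borel" by fact
    show ?thesis
      by (subst nn_integral_return)
        (auto intro!: sigma_finite_measure.borel_measurable_nn_integral)
  qed
  finally show "emeasure (return borel 0 \<star> M) A = emeasure M A"
    using A by simp
qed

lemma conv_power_add:
  assumes G: "real_distribution G"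
  shows "(conv_power G m \<star> conv_power G n) = conv_power G (m + n)"
proof (induction m)
  case 0
  then show ?case by (simp add: return_0_convolution real_distribution_conv_power[OF G])
next
  case (Suc m)
  note F = real_distribution_facts[OF G] real_distribution_facts[OF real_distribution_conv_power[OF G]]
  have "((G \<star> conv_power G m) \<star> conv_power G n) = (G \<star> (conv_power G m \<star> conv_power G n))"
    by (rule convolution_associative[symmetric]) (simp_all add: F)
  then show ?case using Suc by simp
qed

lemma neg_binomial_weight_pochhammer:
  assumes "0 < a"
  shows "neg_binomial_weight a q n = pochhammer a n / fact n * (1 - q) powr a * q ^ n"
proof -
  have "a \<notin> \<int>\<^sub>\<le>\<^sub>0" using assms by (auto elim!: nonpos_Ints_cases)
  then show ?thesis
    unfolding neg_binomial_weight_def by (simp add: pochhammer_Gamma)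
qed

lemma neg_binomial_weight_pos:
  assumes "0 < a" "0 < q" "q < 1"
  shows "0 < neg_binomial_weight a q n"
  using assms by (simp add: neg_binomial_weight_pochhammer pochhammer_pos)

text \<open>The Vandermonde identity for rising factorials; it makes the weights a convolution semigroup in \<open>a\<close>.\<close>

lemma neg_binomial_weight_convolution:
  assumes "0 < a" "0 < b" "0 < q" "q < 1"
  shows "(\<Sum>k\<le>n. neg_binomial_weight a q k * neg_binomial_weight b q (n - k)) =
    neg_binomial_weight (a + b) q n"
proof -
  have "(\<Sum>k\<le>n. neg_binomial_weight a q k * neg_binomial_weight b q (n - k)) =
     (\<Sum>k\<le>n. (of_nat (n choose k) * pochhammer a k * pochhammer b (n - k)) *
        ((1 - q) powr (a + b) * q ^ n / fact n))"
  proof (rule sum.cong[OF refl])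
    fix k assume "k \<in> {..n}"
    then have k: "k \<le> n" by simp
    have "q ^ n = q ^ k * q ^ (n - k)" using k by (simp flip: power_add)
    then show "neg_binomial_weight a q k * neg_binomial_weight b q (n - k) =
       (of_nat (n choose k) * pochhammer a k * pochhammer b (n - k)) *
        ((1 - q) powr (a + b) * q ^ n / fact n)"
      using assms k by (simp add: neg_binomial_weight_pochhammer binomial_fact powr_add field_simps)
  qed
  also have "\<dots> = pochhammer (a + b) n * ((1 - q) powr (a + b) * q ^ n / fact n)"
    by (simp only: pochhammer_binomial_sum sum_distrib_right)
  also have "\<dots> = neg_binomial_weight (a + b) q n"
    using assms by (simp add: neg_binomial_weight_pochhammer)
  finally show ?thesis .
qed

text \<open>The compound distribution is the mixture of the laws \<open>conv_power G n\<close> with the weights as mixing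
  measure, that is, a monadic bind; integration against a bind is known.\<close>

lemma nn_integral_compound_neg_binomial:
  assumes G: "real_distribution G" and h [measurable]: "h \<in> borel_measurable borel"
  shows "(\<integral>\<^sup>+s. h s \<partial>compound_neg_binomial a q G) =
    (\<Sum>n. ennreal (neg_binomial_weight a q n) * (\<integral>\<^sup>+s. h s \<partial>conv_power G n))"
proof -
  define W where "W = density (count_space UNIV) (\<lambda>n. ennreal (neg_binomial_weight a q n))"
  note S = real_distribution_facts[OF real_distribution_conv_power[OF G]]
  have K: "conv_power G \<in> measurable W (subprob_algebra borel)"
    unfolding W_def using S
    by (auto simp: measurable_count_space_eq1 space_subprob_algebra prob_space_imp_subprob_space)
  have int: "(\<integral>\<^sup>+n. u n \<partial>W) = (\<Sum>n. ennreal (neg_binomial_weight a q n) * u n)" for u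
    unfolding W_def by (simp add: nn_integral_density nn_integral_count_space_nat)
  have "compound_neg_binomial a q G = W \<bind> conv_power G"
  proof (rule measure_eqI)
    show "sets (compound_neg_binomial a q G) = sets (W \<bind> conv_power G)"
      using sets_bind[of W "conv_power G" borel] sets.sigma_sets_eq[of "borel :: real measure"]
      by (simp add: compound_neg_binomial_def S W_def)
    fix A assume "A \<in> sets (compound_neg_binomial a q G)"
    then have A: "A \<in> sets borel"
      using sets.sigma_sets_eq[of "borel :: real measure"] by (simp add: compound_neg_binomial_def)
    show "emeasure (compound_neg_binomial a q G) A = emeasure (W \<bind> conv_power G) A"
      using A by (subst emeasure_bind[OF _ K]) (simp_all add: emeasure_compound_neg_binomial[OF G] int, simp add: W_def)
  qed
  then show ?thesis
    by (simp add: nn_integral_bind[OF h K] int)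
qed


text \<open>A bounded function becomes non-negative after adding a constant, and the weights sum to \<open>1\<close>, so
  the constant can be removed again from both sides.\<close>

lemma compound_integral_sums:
  assumes G: "real_distribution G" and w: "0 < a" "0 < q" "q < 1"
    and h [measurable]: "h \<in> borel_measurable borel" and b: "\<And>x. \<bar>h x\<bar> \<le> C"
  shows "(\<lambda>n. neg_binomial_weight a q n * (\<integral>s. h s \<partial>conv_power G n)) sums
    (\<integral>s. h s \<partial>compound_neg_binomial a q G)"
proof -
  let ?F = "compound_neg_binomial a q G"
  let ?w = "neg_binomial_weight a q"
  have F: "real_distribution ?F"
    using real_distribution_compound_neg_binomial[OF G w] .
  have int2: "(\<integral>s. h s + C \<partial>M) = (\<integral>s. h s \<partial>M) + C"
    and nn: "(\<integral>\<^sup>+s. ennreal (h s + C) \<partial>M) = ennreal (\<integral>s. h s + C \<partial>M)"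
    and pos: "0 \<le> (\<integral>s. h s + C \<partial>M)"
    if M: "real_distribution M" for M
  proof -
    interpret real_distribution M by fact
    have I: "integrable M h"
      by (rule integrable_const_bound[where B = C]) (use b in auto)
    from I show "(\<integral>s. h s + C \<partial>M) = (\<integral>s. h s \<partial>M) + C"
      using prob_space by simp
    have p: "0 \<le> h s + C" for s using b[of s] by linarith
    show "(\<integral>\<^sup>+s. ennreal (h s + C) \<partial>M) = ennreal (\<integral>s. h s + C \<partial>M)"
      using I p by (intro nn_integral_eq_integral) auto
    show "0 \<le> (\<integral>s. h s + C \<partial>M)" using p by simp
  qed
  note Gn = real_distribution_conv_power[OF G]
  have wn: "0 \<le> ?w n" for n using neg_binomial_weight_nonneg[OF w] .
  have "ennreal (\<integral>s. h s + C \<partial>?F) =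
      (\<Sum>n. ennreal (?w n) * (\<integral>\<^sup>+s. ennreal (h s + C) \<partial>conv_power G n))"
    unfolding nn[OF F, symmetric] by (rule nn_integral_compound_neg_binomial[OF G]) simp
  also have "\<dots> = (\<Sum>n. ennreal (?w n * (\<integral>s. h s + C \<partial>conv_power G n)))"
    by (simp only: nn[OF Gn] ennreal_mult[OF wn pos[OF Gn]])
  finally have "(\<lambda>n. ennreal (?w n * (\<integral>s. h s + C \<partial>conv_power G n))) sums
      ennreal (\<integral>s. h s + C \<partial>?F)"
    by (simp add: sums_iff)
  then have "(\<lambda>n. ?w n * (\<integral>s. h s + C \<partial>conv_power G n)) sums (\<integral>s. h s + C \<partial>?F)"
    using wn pos[OF Gn] pos[OF F] by (subst (asm) sums_ennreal) auto
  from sums_diff[OF this sums_mult[OF neg_binomial_weight_sums[OF w], of C]]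
  show ?thesis
    unfolding int2[OF F] int2[OF Gn] by (simp add: algebra_simps)
qed

lemma smear_compound_sums:
  assumes G: "real_distribution G" and w: "0 < a" "0 < q" "q < 1"
    and h [measurable]: "h \<in> borel_measurable borel" and b: "\<And>x. \<bar>h x\<bar> \<le> C"
  shows "(\<lambda>n. neg_binomial_weight a q n * smear (conv_power G n) h x) sums
    smear (compound_neg_binomial a q G) h x"
  unfolding smear_def
  by (rule compound_integral_sums[OF G w, where C = C]) (use b in auto)

lemma measure_compound_sums:
  assumes G: "real_distribution G" and w: "0 < a" "0 < q" "q < 1"
    and A [measurable]: "A \<in> sets borel"
  shows "(\<lambda>n. neg_binomial_weight a q n * measure (conv_power G n) A) sums
    measure (compound_neg_binomial a q G) A"
proof -
  have "(\<lambda>n. neg_binomial_weight a q n * (\<integral>s. indicat_real A s \<partial>conv_power G n)) sums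
    (\<integral>s. indicat_real A s \<partial>compound_neg_binomial a q G)"
    by (rule compound_integral_sums[OF G w, where C = 1]) (auto simp: indicator_def)
  moreover have "(\<integral>s. indicat_real A s \<partial>M) = measure M A" if "real_distribution M" for M
    using A real_distribution_facts(4,5)[OF that] by simp
  ultimately show ?thesis
    using real_distribution_compound_neg_binomial[OF G w] real_distribution_conv_power[OF G] by simp
qed

lemma local_prob_compound_sums:
  assumes "real_distribution G" and "0 < a" "0 < q" "q < 1"
  shows "(\<lambda>n. neg_binomial_weight a q n * local_prob c (conv_power G n) x) sums
    local_prob c (compound_neg_binomial a q G) x"
  unfolding local_prob_def by (rule measure_compound_sums[OF assms]) simp

lemma conv_power_le_compound:
  assumes G: "real_distribution G" and w: "0 < a" "0 < q" "q < 1"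
  shows "measure (conv_power G n) A \<le> 1 / neg_binomial_weight a q n * measure (compound_neg_binomial a q G) A"
proof (cases "A \<in> sets borel")
  case True
  have "neg_binomial_weight a q n * measure (conv_power G n) A \<le> measure (compound_neg_binomial a q G) A"
    using sum_le_suminf[OF sums_summable[OF measure_compound_sums[OF G w True]], of "{n}"]
      sums_unique[OF measure_compound_sums[OF G w True]] neg_binomial_weight_nonneg[OF w] by simp
  then show ?thesis
    using neg_binomial_weight_pos[OF w, of n] by (simp add: field_simps)
next
  case False
  then show ?thesis
    using real_distribution_facts(4)[OF real_distribution_conv_power[OF G, of n]]
    by (simp add: measure_notin_sets measure_nonneg neg_binomial_weight_nonneg[OF w])
qed

text \<open>The semigroup property. With \<open>a = b\<close> it controls the second convolution power of the compound
  distribution, both when subexponentiality of that distribution is proved and when it is used;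
  for general parameters it allows inverting the convolution in \<open>compound_tauberian\<close>.\<close>

lemma compound_convolution:
  assumes G: "real_distribution G" and a: "0 < a" and b: "0 < b" and q: "0 < q" "q < 1"
  shows "(compound_neg_binomial a q G \<star> compound_neg_binomial b q G) = compound_neg_binomial (a + b) q G"
    (is "(?Fa \<star> ?Fb) = ?Fab")
proof (rule measure_eqI)
  note Fa = real_distribution_facts[OF real_distribution_compound_neg_binomial[OF G a q]]
  note Fb = real_distribution_facts[OF real_distribution_compound_neg_binomial[OF G b q]]
  note Gn = real_distribution_facts[OF real_distribution_conv_power[OF G]]
  have ab: "0 < a + b" using a b by simp
  show "sets (?Fa \<star> ?Fb) = sets ?Fab"
    using real_distribution_facts(4)[OF real_distribution_compound_neg_binomial[OF G ab q]] by simp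
  fix A assume "A \<in> sets (?Fa \<star> ?Fb)"
  then have A [measurable]: "A \<in> sets borel" by simp
  let ?w = "\<lambda>a n. ennreal (neg_binomial_weight a q n)"
  let ?I = "\<lambda>m n. emeasure (conv_power G (m + n)) A"
  have mb [measurable]: "(\<lambda>x. \<integral>\<^sup>+y. indicator A (x + y) \<partial>M) \<in> borel_measurable borel"
    if M: "real_distribution M" for M
  proof -
    interpret real_distribution M by fact
    show ?thesis by measurable
  qed
  have "emeasure (?Fa \<star> ?Fb) A = (\<integral>\<^sup>+x. \<integral>\<^sup>+y. indicator A (x + y) \<partial>?Fb \<partial>?Fa)"
    by (rule convolution_emeasure') (simp_all add: Fa Fb)
  also have "\<dots> = (\<Sum>m. ?w a m * (\<integral>\<^sup>+x. \<integral>\<^sup>+y. indicator A (x + y) \<partial>?Fb \<partial>conv_power G m))"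
    by (rule nn_integral_compound_neg_binomial[OF G mb]) (rule real_distribution_compound_neg_binomial[OF G b q])
  also have "\<dots> = (\<Sum>m. ?w a m * (\<Sum>n. ?w b n * ?I m n))"
  proof (rule suminf_cong)
    fix m
    have "(\<integral>\<^sup>+x. \<integral>\<^sup>+y. indicator A (x + y) \<partial>?Fb \<partial>conv_power G m) =
        emeasure (conv_power G m \<star> ?Fb) A"
      by (rule convolution_emeasure'[symmetric]) (simp_all add: Fb Gn)
    also have "\<dots> = emeasure (?Fb \<star> conv_power G m) A"
      by (subst convolution_commutative) (simp_all add: Fb Gn)
    also have "\<dots> = (\<integral>\<^sup>+x. \<integral>\<^sup>+y. indicator A (x + y) \<partial>conv_power G m \<partial>?Fb)"
      by (rule convolution_emeasure') (simp_all add: Gn Fb)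
    also have "\<dots> = (\<Sum>n. ?w b n * (\<integral>\<^sup>+x. \<integral>\<^sup>+y. indicator A (x + y) \<partial>conv_power G m \<partial>conv_power G n))"
      by (rule nn_integral_compound_neg_binomial[OF G mb]) (rule real_distribution_conv_power[OF G])
    also have "\<dots> = (\<Sum>n. ?w b n * ?I m n)"
      by (simp add: convolution_emeasure'[symmetric] Gn conv_power_add[OF G] add.commute)
    finally show "?w a m * (\<integral>\<^sup>+x. \<integral>\<^sup>+y. indicator A (x + y) \<partial>?Fb \<partial>conv_power G m) =
      ?w a m * (\<Sum>n. ?w b n * ?I m n)" by simp
  qed
  also have "\<dots> = (\<Sum>m. \<Sum>k. if m \<le> k then ?w a m * ?w b (k - m) * emeasure (conv_power G k) A else 0)"
    (is "_ = (\<Sum>m. \<Sum>k. ?H m k)")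
  proof (rule suminf_cong)
    fix m
    have "(\<Sum>k. ?H m k) = (\<Sum>k. ?H m (k + m)) + (\<Sum>k<m. ?H m k)"
      by (rule suminf_offset[OF summableI])
    also have "(\<Sum>k<m. ?H m k) = 0" by simp
    also have "(\<Sum>k. ?H m (k + m)) = (\<Sum>k. ?w a m * (?w b k * ?I m k))"
      by (simp add: mult.assoc add.commute)
    also have "\<dots> = ?w a m * (\<Sum>n. ?w b n * ?I m n)"
      by (rule ennreal_suminf_cmult)
    finally show "?w a m * (\<Sum>n. ?w b n * ?I m n) = (\<Sum>k. ?H m k)"
      by simp
  qed
  also have "\<dots> = (\<Sum>k. \<Sum>m. ?H m k)"
    using nn_integral_suminf[of "\<lambda>k m. ?H m k" "count_space UNIV"]
    by (simp only: nn_integral_count_space_nat borel_measurable_count_space)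
  also have "\<dots> = (\<Sum>k. ?w (a + b) k * emeasure (conv_power G k) A)"
  proof (rule suminf_cong)
    fix k
    have "(\<Sum>m. ?H m k) = (\<Sum>m\<le>k. ?H m k)"
      by (rule suminf_finite) auto
    also have "\<dots> = (\<Sum>m\<le>k. ennreal (neg_binomial_weight a q m * neg_binomial_weight b q (k - m))) *
        emeasure (conv_power G k) A"
      by (simp add: sum_distrib_right ennreal_mult neg_binomial_weight_nonneg[OF a q]
          neg_binomial_weight_nonneg[OF b q])
    also have "(\<Sum>m\<le>k. ennreal (neg_binomial_weight a q m * neg_binomial_weight b q (k - m))) = ?w (a + b) k"
      by (subst sum_ennreal) (simp_all add: neg_binomial_weight_convolution[OF a b q]
          neg_binomial_weight_nonneg[OF a q] neg_binomial_weight_nonneg[OF b q])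
    finally show "(\<Sum>m. ?H m k) = ?w (a + b) k * emeasure (conv_power G k) A" .
  qed
  also have "\<dots> = emeasure ?Fab A"
    by (rule emeasure_compound_neg_binomial[OF G A, symmetric])
  finally show "emeasure (?Fa \<star> ?Fb) A = emeasure ?Fab A" .
qed

section \<open>Long-tailed local probabilities\<close>

lemma asymp_equiv_cmult_iff:
  fixes f g :: "real \<Rightarrow> real"
  assumes pos: "\<forall>\<^sub>F x in at_top. 0 < g x" and k: "0 < k"
  shows "f \<sim>[at_top] (\<lambda>x. k * g x) \<longleftrightarrow> ((\<lambda>x. f x / g x) \<longlongrightarrow> k) at_top"
proof
  assume "f \<sim>[at_top] (\<lambda>x. k * g x)"
  moreover have "\<forall>\<^sub>F x in at_top. f x \<noteq> 0 \<or> k * g x \<noteq> 0"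
    using pos by eventually_elim (use k in auto)
  ultimately have "((\<lambda>x. f x / (k * g x)) \<longlongrightarrow> 1) at_top"
    by (rule asymp_equivD_strong)
  from tendsto_mult_left[OF this, of k] show "((\<lambda>x. f x / g x) \<longlongrightarrow> k) at_top"
    using k by simp
next
  assume "((\<lambda>x. f x / g x) \<longlongrightarrow> k) at_top"
  then show "f \<sim>[at_top] (\<lambda>x. k * g x)"
    using k by (intro asymp_equivI'_const) auto
qed

lemma filterlim_add_const_at_top:
  "filterlim (\<lambda>x. x + y) at_top (at_top :: real filter)"
  using filterlim_tendsto_add_at_top[OF tendsto_const[of y] filterlim_ident]
  by (simp add: add.commute)

lemma class_L_pos:
  assumes "f \<in> class_L"
  shows "\<forall>\<^sub>F x in at_top. 0 < f x"
  using assms by (auto simp: class_L_def eventually_at_top_linorder)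

text \<open>A negative shift is undone by substituting \<open>x + y\<close> for \<open>x\<close> and inverting the quotient.\<close>

lemma class_L_ratio:
  assumes f: "f \<in> class_L"
  shows "((\<lambda>x. f (x + y) / f x) \<longlongrightarrow> 1) at_top"
proof -
  have up: "((\<lambda>x. f (x + y) / f x) \<longlongrightarrow> 1) at_top" if "0 < y" for y
    using f that asymp_equiv_cmult_iff[OF class_L_pos[OF f], of 1 "\<lambda>x. f (x + y)"]
    by (simp add: class_L_def)
  consider "0 < y" | "y = 0" | "y < 0" by linarith
  then show ?thesis
  proof cases
    case 1
    then show ?thesis by (rule up)
  next
    case 2
    have "\<forall>\<^sub>F x in at_top. 1 = f (x + y) / f x"
      using class_L_pos[OF f] by eventually_elim (simp add: 2)
    then show ?thesis by (rule Lim_transform_eventually[OF tendsto_const])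
  next
    case 3
    have "((\<lambda>x. f (x + y + - y) / f (x + y)) \<longlongrightarrow> 1) at_top"
      by (rule filterlim_compose[OF up filterlim_add_const_at_top]) (use 3 in simp)
    from tendsto_inverse[OF this] show ?thesis by simp
  qed
qed

lemma class_L_transfer:
  assumes f: "f \<in> class_L" and h: "h \<in> borel_measurable borel" "\<And>x. 0 \<le> h x"
    and lim: "((\<lambda>x. h x / f x) \<longlongrightarrow> k) at_top" and k: "0 < k"
  shows "h \<in> class_L"
proof -
  have pos: "\<forall>\<^sub>F x in at_top. 0 < h x"
    using class_L_pos[OF f] order_tendstoD(1)[OF lim k]
    by eventually_elim (use h(2) in \<open>simp add: zero_less_divide_iff\<close>)
  then obtain b where "\<forall>x\<ge>b. 0 < h x" by (auto simp: eventually_at_top_linorder)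
  then have "\<exists>x0>0. \<forall>x\<ge>x0. 0 < h x" by (intro exI[of _ "max b 1"]) auto
  moreover have "(\<lambda>x. h (x + y)) \<sim>[at_top] h" for y
  proof -
    have "((\<lambda>x. h (x + y) / f (x + y) * (f (x + y) / f x) / (h x / f x)) \<longlongrightarrow> k * 1 / k) at_top"
      by (intro tendsto_intros filterlim_compose[OF lim filterlim_add_const_at_top]
          class_L_ratio[OF f] lim) (use k in simp)
    moreover have "\<forall>\<^sub>F x in at_top. h (x + y) / f (x + y) * (f (x + y) / f x) / (h x / f x) = h (x + y) / h x"
      using class_L_pos[OF f] eventually_compose_filterlim[OF class_L_pos[OF f] filterlim_add_const_at_top[of y]] pos
      by eventually_elim simp
    ultimately have "((\<lambda>x. h (x + y) / h x) \<longlongrightarrow> 1) at_top"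
      using k by (simp add: Lim_transform_eventually)
    then show ?thesis by (rule asymp_equivI')
  qed
  ultimately show ?thesis using h by (auto simp: class_L_def)
qed

text \<open>Class \<open>class_L\<close> speaks of one shift at a time. For local probabilities a bound that is uniform over
  a compact set of shifts comes for free: \<open>x - s + \<Delta>\<close> is covered by finitely many of the
  intervals \<open>x + k * c + \<Delta>\<close> with integer \<open>k\<close>, and each of these has about the mass of
  \<open>x + \<Delta>\<close>. Together with dominated convergence this bound replaces a uniform convergence theorem.\<close>

lemma local_comparison:
  assumes F: "real_distribution F" and c: "0 < c" and L: "local_prob c F \<in> class_L"
  obtains C x1 where "0 < C"
    "\<And>x s. x1 \<le> x \<Longrightarrow> \<bar>s\<bar> \<le> A \<Longrightarrow> local_prob c F (x - s) \<le> C * local_prob c F x"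
proof -
  interpret real_distribution F by fact
  \<comment> \<open>The number of intervals of length \<open>c\<close> needed on each side to reach a distance \<open>A\<close>.\<close>
  define m where "m = \<lceil>A / c\<rceil>"
  have mc: "A \<le> of_int m * c"
    using c le_of_int_ceiling[of "A / c"] unfolding m_def by (simp only: pos_divide_le_eq)
  have cover: "local_prob c F (x - s) \<le> (\<Sum>k\<in>{-m..m}. local_prob c F (x + of_int k * c))"
    if s: "\<bar>s\<bar> \<le> A" for x s
  proof -
    have "{x - s<..x - s + c} \<subseteq> (\<Union>k\<in>{-m..m}. {x + of_int k * c<..x + of_int k * c + c})"
    proof
      fix y assume y: "y \<in> {x - s<..x - s + c}"
      define k where "k = \<lceil>(y - x) / c\<rceil> - 1"
      have "of_int k < (y - x) / c" "(y - x) / c \<le> of_int k + 1"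
        unfolding k_def by linarith+
      then have k: "of_int k * c < y - x" "y - x \<le> of_int k * c + c"
        using c by (simp_all add: field_simps)
      have "of_int k * c < of_int m * c + c" "of_int (- m) * c < of_int k * c + c"
        using k y s mc by auto
      then have "of_int k * c < of_int (m + 1) * c" "of_int (- m) * c < of_int (k + 1) * c"
        by (simp_all add: algebra_simps)
      then have "k < m + 1" "- m < k + 1"
        using c by (simp_all only: mult_less_cancel_right of_int_less_iff)
      then show "y \<in> (\<Union>k\<in>{-m..m}. {x + of_int k * c<..x + of_int k * c + c})"
        using k by (intro UN_I[of k]) auto
    qed
    then have "local_prob c F (x - s) \<le> measure F (\<Union>k\<in>{-m..m}. {x + of_int k * c<..x + of_int k * c + c})"
      unfolding local_prob_def by (intro finite_measure_mono) auto
    also have "\<dots> \<le> (\<Sum>k\<in>{-m..m}. local_prob c F (x + of_int k * c))"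
      unfolding local_prob_def by (rule finite_measure_subadditive_finite) auto
    finally show ?thesis .
  qed
  have "\<forall>\<^sub>F x in at_top. \<forall>k\<in>{-m..m}. local_prob c F (x + of_int k * c) \<le> 2 * local_prob c F x"
  proof (rule eventually_ball_finite)
    show "\<forall>k\<in>{-m..m}. \<forall>\<^sub>F x in at_top. local_prob c F (x + of_int k * c) \<le> 2 * local_prob c F x"
    proof
      fix k
      show "\<forall>\<^sub>F x in at_top. local_prob c F (x + of_int k * c) \<le> 2 * local_prob c F x"
        using class_L_pos[OF L] order_tendstoD(2)[OF class_L_ratio[OF L, of "of_int k * c"], of 2, simplified]
        by eventually_elim (simp add: field_simps)
    qed
  qed simp
  then obtain x1 where x1: "\<And>x k. x1 \<le> x \<Longrightarrow> k \<in> {-m..m} \<Longrightarrow>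
      local_prob c F (x + of_int k * c) \<le> 2 * local_prob c F x"
    unfolding eventually_at_top_linorder by blast
  define C where "C = 2 * real (card {-m..m}) + 1"
  show thesis
  proof
    show "0 < C" by (simp add: C_def)
    fix x s assume x: "x1 \<le> x" and s: "\<bar>s\<bar> \<le> A"
    have "local_prob c F (x - s) \<le> (\<Sum>k\<in>{-m..m}. local_prob c F (x + of_int k * c))"
      by (rule cover[OF s])
    also have "\<dots> \<le> (\<Sum>k\<in>{-m..m}. 2 * local_prob c F x)"
      using x1[OF x] by (intro sum_mono) auto
    also have "\<dots> \<le> C * local_prob c F x"
      using local_prob_bounds(1)[OF F, of c x] by (simp add: C_def algebra_simps)
    finally show "local_prob c F (x - s) \<le> C * local_prob c F x" .
  qed
qed

text \<open>The integrand divided by \<open>f x\<close> tends pointwise to \<open>\<alpha>\<close>, as \<open>h\<close> is asymptotic to \<open>\<alpha> * f\<close> and \<open>f\<close>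
  is insensitive to shifts; the domination hypothesis allows passing to the limit.\<close>

lemma restricted_smear_limit:
  assumes N: "real_distribution N" and f: "f \<in> class_L"
    and V [measurable]: "V \<in> sets borel" and h [measurable]: "h \<in> borel_measurable borel"
    and lim: "((\<lambda>x. h x / f x) \<longlongrightarrow> \<alpha>) at_top"
    and dom: "AE s in N. s \<in> V \<longrightarrow> (\<forall>x\<ge>x1. \<bar>h (x - s)\<bar> \<le> C * f x)"
  shows "((\<lambda>x. (\<integral>s. indicator V s * h (x - s) \<partial>N) / f x) \<longlongrightarrow> \<alpha> * measure N V) at_top"
proof -
  interpret real_distribution N by fact
  have "((\<lambda>x. \<integral>s. indicator V s * h (x - s) / f x \<partial>N) \<longlongrightarrow> (\<integral>s. \<alpha> * indicator V s \<partial>N)) at_top"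
  proof (rule integral_dominated_convergence_at_top[where w = "\<lambda>_. \<bar>C\<bar>"])
    show "AE s in N. ((\<lambda>x. indicator V s * h (x - s) / f x) \<longlongrightarrow> \<alpha> * indicator V s) at_top"
    proof (rule AE_I2)
      fix s
      have "((\<lambda>x. indicator V s * (h (x + - s) / f (x + - s) * (f (x + - s) / f x))) \<longlongrightarrow>
          indicator V s * (\<alpha> * 1)) at_top"
        by (intro tendsto_intros filterlim_compose[OF lim filterlim_add_const_at_top] class_L_ratio[OF f])
      moreover have "\<forall>\<^sub>F x in at_top. indicator V s * (h (x + - s) / f (x + - s) * (f (x + - s) / f x)) =
          indicator V s * h (x - s) / f x"
        using eventually_compose_filterlim[OF class_L_pos[OF f] filterlim_add_const_at_top[of "-s"]]
        by eventually_elim simp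
      ultimately show "((\<lambda>x. indicator V s * h (x - s) / f x) \<longlongrightarrow> \<alpha> * indicator V s) at_top"
        by (simp add: Lim_transform_eventually mult.commute)
    qed
    have "\<forall>\<^sub>F x in at_top. 0 < f x \<and> x1 \<le> x"
      using class_L_pos[OF f] eventually_ge_at_top by (rule eventually_conj)
    then show "\<forall>\<^sub>F x in at_top. AE s in N. norm (indicator V s * h (x - s) / f x) \<le> \<bar>C\<bar>"
    proof eventually_elim
      case (elim x)
      show ?case
        using dom
      proof eventually_elim
        case (elim s)
        have "s \<in> V \<Longrightarrow> \<bar>h (x - s)\<bar> \<le> \<bar>C\<bar> * f x"
          using elim \<open>0 < f x \<and> x1 \<le> x\<close> by (meson abs_ge_self less_imp_le mult_right_mono order_trans)
        then show ?case
          using \<open>0 < f x \<and> x1 \<le> x\<close> by (auto simp: indicator_def field_simps abs_mult)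
      qed
    qed
    have [measurable]: "f \<in> borel_measurable borel" using f by (simp add: class_L_def)
  qed auto
  then show ?thesis by simp
qed

lemma window_smear_limit:
  assumes F: "real_distribution F" and c: "0 < c" and L: "local_prob c F \<in> class_L"
    and N: "real_distribution N" and h [measurable]: "h \<in> borel_measurable borel"
    and lim: "((\<lambda>x. h x / local_prob c F x) \<longlongrightarrow> \<alpha>) at_top"
  shows "((\<lambda>x. (\<integral>s. indicator {-A..A} s * h (x - s) \<partial>N) / local_prob c F x) \<longlongrightarrow>
    \<alpha> * measure N {-A..A}) at_top"
proof -
  obtain C x1 where C: "0 < C"
    "\<And>x s. x1 \<le> x \<Longrightarrow> \<bar>s\<bar> \<le> A \<Longrightarrow> local_prob c F (x - s) \<le> C * local_prob c F x"
    using local_comparison[OF F c L, of A] by blast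
  have "((\<lambda>x. \<bar>h x / local_prob c F x\<bar>) \<longlongrightarrow> \<bar>\<alpha>\<bar>) at_top"
    by (intro tendsto_intros lim)
  then have "\<forall>\<^sub>F x in at_top. \<bar>h x / local_prob c F x\<bar> < \<bar>\<alpha>\<bar> + 1"
    by (rule order_tendstoD) simp
  then have "\<forall>\<^sub>F x in at_top. \<bar>h x\<bar> \<le> (\<bar>\<alpha>\<bar> + 1) * local_prob c F x"
    using class_L_pos[OF L] by eventually_elim (simp add: field_simps)
  then obtain x2 where x2: "\<And>x. x2 \<le> x \<Longrightarrow> \<bar>h x\<bar> \<le> (\<bar>\<alpha>\<bar> + 1) * local_prob c F x"
    by (auto simp: eventually_at_top_linorder)
  show ?thesis
  proof (rule restricted_smear_limit[OF N L _ h lim, where C = "(\<bar>\<alpha>\<bar> + 1) * C"])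
    have "\<bar>h (x - s)\<bar> \<le> (\<bar>\<alpha>\<bar> + 1) * C * local_prob c F x"
      if "s \<in> {-A..A}" "max x1 (x2 + A) \<le> x" for s x
    proof -
      have "\<bar>h (x - s)\<bar> \<le> (\<bar>\<alpha>\<bar> + 1) * local_prob c F (x - s)"
        using that by (intro x2) auto
      also have "\<dots> \<le> (\<bar>\<alpha>\<bar> + 1) * (C * local_prob c F x)"
        using that by (intro mult_left_mono C(2)) auto
      finally show ?thesis by (simp add: mult.assoc)
    qed
    then show "AE s in N. s \<in> {-A..A} \<longrightarrow>
        (\<forall>x\<ge>max x1 (x2 + A). \<bar>h (x - s)\<bar> \<le> (\<bar>\<alpha>\<bar> + 1) * C * local_prob c F x)"
      by (intro AE_I2) blast
  qed simp
qed

lemma measure_window_tendsto: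
  assumes N: "real_distribution N"
  shows "((\<lambda>A. measure N {-A..A}) \<longlongrightarrow> 1) at_top"
proof -
  interpret real_distribution N by fact
  have "((\<lambda>A. measure N {-A..A}) \<longlongrightarrow> measure N UNIV) at_top"
  proof (rule tendsto_at_topI_sequentially_real)
    show "mono (\<lambda>A. measure N {-A..A})"
      by (auto simp: mono_def intro!: finite_measure_mono)
    have "(\<Union>n. {-real n..real n}) = UNIV"
    proof -
      have "x \<in> {-real (nat \<lceil>\<bar>x\<bar>\<rceil>)..real (nat \<lceil>\<bar>x\<bar>\<rceil>)}" for x by auto linarith+
      then show ?thesis by blast
    qed
    moreover have "(\<lambda>n. measure N {-real n..real n}) \<longlonglongrightarrow> measure N (\<Union>n. {-real n..real n})"
      by (rule finite_Lim_measure_incseq) (auto simp: incseq_def)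
    ultimately show "(\<lambda>n. measure N {-real n..real n}) \<longlonglongrightarrow> measure N UNIV" by simp
  qed
  then show ?thesis using real_distribution_facts(6)[OF N] by simp
qed

text \<open>A Fatou bound: the events that \<open>X\<close> is large while \<open>Y\<close> stays in a fixed window, and the same with
  the roles exchanged, are disjoint once \<open>x\<close> exceeds twice the window, and they contribute almost
  \<open>\<alpha>\<close> and \<open>\<beta>\<close>. Truncating a local probability at \<open>\<gamma>\<close> times that of \<open>F\<close> turns its lower bound
  into a limit, to which the window limit applies.\<close>

lemma local_prob_convolution_liminf:
  assumes F: "real_distribution F" and c: "0 < c" and L: "local_prob c F \<in> class_L"
    and M: "real_distribution M" and N: "real_distribution N" and ab: "0 \<le> \<alpha>" "0 \<le> \<beta>"
    and m: "\<And>e. 0 < e \<Longrightarrow> \<forall>\<^sub>F x in at_top. (\<alpha> - e) * local_prob c F x \<le> local_prob c M x"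
    and n: "\<And>e. 0 < e \<Longrightarrow> \<forall>\<^sub>F x in at_top. (\<beta> - e) * local_prob c F x \<le> local_prob c N x"
    and e: "0 < e"
  shows "\<forall>\<^sub>F x in at_top. (\<alpha> + \<beta> - e) * local_prob c F x \<le> local_prob c (M \<star> N) x"
proof -
  let ?f = "local_prob c F"
  have key: "((\<lambda>x. (\<integral>s. indicator {-A..A} s * min (local_prob c P (x - s)) (\<gamma> * ?f (x - s)) \<partial>Q) / ?f x)
        \<longlongrightarrow> \<gamma> * measure Q {-A..A}) at_top"
    and le: "(\<integral>s. indicator {-A..A} s * min (local_prob c P (x - s)) (\<gamma> * ?f (x - s)) \<partial>Q) \<le>
        (\<integral>s. indicator {-A..A} s * local_prob c P (x - s) \<partial>Q)"
    if P: "real_distribution P" and Q: "real_distribution Q" and g: "0 \<le> \<gamma>"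
      and p: "\<And>e. 0 < e \<Longrightarrow> \<forall>\<^sub>F x in at_top. (\<gamma> - e) * ?f x \<le> local_prob c P x"
    for P Q \<gamma> A x
  proof -
    have [measurable]: "?f \<in> borel_measurable borel" "local_prob c P \<in> borel_measurable borel"
      using F P c by auto
    have "((\<lambda>x. min (local_prob c P x) (\<gamma> * ?f x) / ?f x) \<longlongrightarrow> \<gamma>) at_top"
    proof (rule tendstoI)
      fix d :: real assume d: "0 < d"
      show "\<forall>\<^sub>F x in at_top. dist (min (local_prob c P x) (\<gamma> * ?f x) / ?f x) \<gamma> < d"
        using p[OF half_gt_zero[OF d]] class_L_pos[OF L]
      proof eventually_elim
        case (elim x)
        have "(\<gamma> - d / 2) * ?f x \<le> min (local_prob c P x) (\<gamma> * ?f x)"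
          using elim d by (simp add: algebra_simps)
        then have "\<gamma> - d / 2 \<le> min (local_prob c P x) (\<gamma> * ?f x) / ?f x"
          using elim by (simp add: pos_le_divide_eq)
        moreover have "min (local_prob c P x) (\<gamma> * ?f x) / ?f x \<le> \<gamma>"
          using elim by (simp add: pos_divide_le_eq)
        ultimately show ?case using d by (simp add: dist_real_def)
      qed
    qed
    then show "((\<lambda>x. (\<integral>s. indicator {-A..A} s * min (local_prob c P (x - s)) (\<gamma> * ?f (x - s)) \<partial>Q) / ?f x)
        \<longlongrightarrow> \<gamma> * measure Q {-A..A}) at_top"
      by (intro window_smear_limit[OF F c L Q]) measurable
    interpret Q: real_distribution Q by fact
    have min_le: "\<bar>min (local_prob c P y) (\<gamma> * ?f y)\<bar> \<le> 1" for y
      using local_prob_bounds[OF P, of c y] local_prob_bounds(1)[OF F, of c y] g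
      by (simp add: min.coboundedI1)
    show "(\<integral>s. indicator {-A..A} s * min (local_prob c P (x - s)) (\<gamma> * ?f (x - s)) \<partial>Q) \<le>
        (\<integral>s. indicator {-A..A} s * local_prob c P (x - s) \<partial>Q)"
    proof (rule integral_mono)
      show "integrable Q (\<lambda>s. indicator {-A..A} s * min (local_prob c P (x - s)) (\<gamma> * ?f (x - s)))"
        by (rule Q.integrable_const_bound[where B = 1])
          (use min_le in \<open>auto simp: indicator_def\<close>)
      show "integrable Q (\<lambda>s. indicator {-A..A} s * local_prob c P (x - s))"
        by (rule Q.integrable_const_bound[where B = 1])
          (use local_prob_bounds[OF P] in \<open>auto simp: indicator_def\<close>)
    qed (auto simp: indicator_def)
  qed
  have "((\<lambda>A. \<alpha> * measure N {-A..A} + \<beta> * measure M {-A..A}) \<longlongrightarrow> \<alpha> * 1 + \<beta> * 1) at_top"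
    by (intro tendsto_intros measure_window_tendsto M N)
  then have "\<forall>\<^sub>F A in at_top. \<alpha> + \<beta> - e < \<alpha> * measure N {-A..A} + \<beta> * measure M {-A..A}"
    by (rule order_tendstoD) (use e in simp)
  then obtain A where A: "\<alpha> + \<beta> - e < \<alpha> * measure N {-A..A} + \<beta> * measure M {-A..A}"
    using eventually_happens'[OF trivial_limit_at_top_linorder] by blast
  let ?U = "UNIV \<times> {-A..A}" and ?V = "{-A..A} \<times> UNIV"
  let ?p = "\<lambda>x. (\<integral>s. indicator {-A..A} s * min (local_prob c M (x - s)) (\<alpha> * ?f (x - s)) \<partial>N)"
  let ?q = "\<lambda>x. (\<integral>s. indicator {-A..A} s * min (local_prob c N (x - s)) (\<beta> * ?f (x - s)) \<partial>M)"
  have "((\<lambda>x. ?p x / ?f x + ?q x / ?f x) \<longlongrightarrow> \<alpha> * measure N {-A..A} + \<beta> * measure M {-A..A}) at_top"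
    by (intro tendsto_add key M N ab m n)
  then have "\<forall>\<^sub>F x in at_top. \<alpha> + \<beta> - e < ?p x / ?f x + ?q x / ?f x"
    by (rule order_tendstoD) (rule A)
  then show ?thesis
    using class_L_pos[OF L] eventually_gt_at_top[of "2 * A"]
  proof eventually_elim
    case (elim x)
    have "(\<alpha> + \<beta> - e) * ?f x \<le> ?p x + ?q x"
      using elim by (simp add: field_simps)
    also have "\<dots> \<le> joint_mass c M N ?U x + joint_mass c M N ?V x"
      unfolding joint_mass_snd[OF M N atLeastAtMost_borel] joint_mass_fst[OF M N atLeastAtMost_borel]
      by (intro add_mono le M N ab m n)
    also have "\<dots> = joint_mass c M N (?U \<union> ?V) x"
      using elim by (intro joint_mass_Un[symmetric] M N) auto
    also have "\<dots> \<le> joint_mass c M N UNIV x"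
      by (intro joint_mass_mono M N) auto
    finally show ?case by (simp add: joint_mass_UNIV[OF M N])
  qed
qed

section \<open>Convolution powers of a subexponential distribution\<close>

lemma class_S_DeltaD:
  assumes c: "0 < c" and S: "G \<in> class_S_Delta c"
  shows "real_distribution G" "local_prob c G \<in> class_L"
    "((\<lambda>x. local_prob c (G \<star> G) x / local_prob c G x) \<longlongrightarrow> 2) at_top"
proof -
  show G: "real_distribution G" and L: "local_prob c G \<in> class_L"
    using S by (auto simp: class_S_Delta_def class_L_Delta_def)
  show "((\<lambda>x. local_prob c (G \<star> G) x / local_prob c G x) \<longlongrightarrow> 2) at_top"
    using S asymp_equiv_cmult_iff[OF class_L_pos[OF L], of 2 "local_prob c (G \<star> G)"]
    by (simp add: class_S_Delta_def conv_power_2[OF G])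
qed

lemma class_S_DeltaI:
  assumes G: "real_distribution G" and L: "local_prob c G \<in> class_L"
    and lim: "((\<lambda>x. local_prob c (G \<star> G) x / local_prob c G x) \<longlongrightarrow> 2) at_top"
  shows "G \<in> class_S_Delta c"
  using assms asymp_equiv_cmult_iff[OF class_L_pos[OF L], of 2 "local_prob c (G \<star> G)"]
  by (simp add: class_S_Delta_def class_L_Delta_def conv_power_2[OF G])

lemma conv_power_nonneg:
  assumes G: "real_distribution G" and p: "measure G {0..} = 1"
  shows "AE s in conv_power G n. 0 \<le> s"
proof -
  note Gn = real_distribution_facts[OF real_distribution_conv_power[OF G]]
  note GG = real_distribution_facts[OF G]
  have G0: "AE s in G. 0 \<le> s"
    using prob_space.prob_eq_1[OF GG(2), of "{0..}"] p by (simp add: GG)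
  have iff: "(AE s in M. 0 \<le> s) \<longleftrightarrow> emeasure M {..<0} = 0" if "real_distribution M" for M :: "real measure"
  proof -
    note real_distribution_facts[OF that, simp]
    have "(AE s in M. 0 \<le> s) \<longleftrightarrow> (AE s in M. s \<notin> {..<0})"
      by (intro AE_cong) auto
    also have "\<dots> \<longleftrightarrow> {..<0} \<in> null_sets M"
      by (rule AE_iff_null_sets[symmetric]) simp
    finally show ?thesis by (simp add: null_sets_def)
  qed
  show ?thesis
  proof (induction n)
    case 0
    show ?case
      unfolding conv_power.simps by (subst AE_return) auto
  next
    case (Suc n)
    have "emeasure (G \<star> conv_power G n) {..<0} =
        (\<integral>\<^sup>+x. \<integral>\<^sup>+y. indicator {..<0} (x + y) \<partial>conv_power G n \<partial>G)"
      by (rule convolution_emeasure') (simp_all add: Gn GG)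
    also have "\<dots> = (\<integral>\<^sup>+x. 0 \<partial>G)"
    proof (rule nn_integral_cong_AE)
      show "AE x in G. (\<integral>\<^sup>+y. indicator {..<0} (x + y) \<partial>conv_power G n) = (0 :: ennreal)"
        using G0
      proof eventually_elim
        case (elim x)
        have "(\<integral>\<^sup>+y. indicator {..<0} (x + y) \<partial>conv_power G n) = (\<integral>\<^sup>+y. (0::ennreal) \<partial>conv_power G n)"
          by (rule nn_integral_cong_AE) (use Suc in \<open>eventually_elim, use elim in auto\<close>)
        then show ?case by simp
      qed
    qed
    finally show ?case
      using iff[OF real_distribution_conv_power[OF G, of "Suc n"]] by simp
  qed
qed

text \<open>The two cases of the theorem, almost decreasing local probabilities and distributions on the
  half-line, share this consequence: negative summands raise the local probability by a bounded
  factor at most, in the second case because they do not occur.\<close>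

lemma left_shift_domination:
  assumes G: "real_distribution G"
    and "almost_decreasing (local_prob c G) \<or> measure G {0..} = 1"
  obtains K x0 where "\<And>n. AE s in conv_power G n. s < 0 \<longrightarrow>
    (\<forall>x\<ge>x0. local_prob c G (x - s) \<le> K * local_prob c G x)"
  using assms(2)
proof
  assume "almost_decreasing (local_prob c G)"
  then obtain K x0 where K: "\<And>x y. x0 < x \<Longrightarrow> 0 < y \<Longrightarrow> local_prob c G (x + y) \<le> K * local_prob c G x"
    unfolding almost_decreasing_def by blast
  have "local_prob c G (x - s) \<le> K * local_prob c G x" if "s < 0" "x0 + 1 \<le> x" for s x
    using K[of x "- s"] that by simp
  then show thesis
    by (intro that[of "x0 + 1" K] AE_I2) blast
next
  assume "measure G {0..} = 1"
  then have "AE s in conv_power G n. s < 0 \<longrightarrow>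
    (\<forall>x\<ge>0. local_prob c G (x - s) \<le> 0 * local_prob c G x)" for n
    using conv_power_nonneg[OF G, of n] by auto
  then show thesis by (rule that)
qed

lemma left_window_domination:
  assumes G: "real_distribution G" and c: "0 < c" and L: "local_prob c G \<in> class_L"
    and dom: "almost_decreasing (local_prob c G) \<or> measure G {0..} = 1"
  obtains C x1 where "0 < C" "\<And>n. AE s in conv_power G n. s \<in> {..b} \<longrightarrow>
    (\<forall>x\<ge>x1. local_prob c G (x - s) \<le> C * local_prob c G x)"
proof -
  obtain K x0 where K: "\<And>n. AE s in conv_power G n. s < 0 \<longrightarrow>
    (\<forall>x\<ge>x0. local_prob c G (x - s) \<le> K * local_prob c G x)"
    using left_shift_domination[OF G dom] by blast
  obtain C x1 where C: "0 < C"
    "\<And>x s. x1 \<le> x \<Longrightarrow> \<bar>s\<bar> \<le> b \<Longrightarrow> local_prob c G (x - s) \<le> C * local_prob c G x"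
    using local_comparison[OF G c L, of b] by blast
  show thesis
  proof
    show "0 < max K C" using C by simp
    fix n
    show "AE s in conv_power G n. s \<in> {..b} \<longrightarrow>
        (\<forall>x\<ge>max x0 x1. local_prob c G (x - s) \<le> max K C * local_prob c G x)"
      using K[of n]
    proof eventually_elim
      case (elim s)
      show ?case
      proof (intro impI allI)
        fix x assume s: "s \<in> {..b}" and x: "max x0 x1 \<le> x"
        have "local_prob c G (x - s) \<le> K * local_prob c G x \<or> local_prob c G (x - s) \<le> C * local_prob c G x"
          using elim x s C(2)[of x s] by (cases "s < 0") auto
        moreover have "K * local_prob c G x \<le> max K C * local_prob c G x"
          "C * local_prob c G x \<le> max K C * local_prob c G x"
          using local_prob_bounds(1)[OF G, of c x] by (auto intro: mult_right_mono)
        ultimately show "local_prob c G (x - s) \<le> max K C * local_prob c G x" by linarith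
      qed
    qed
  qed
qed

text \<open>A local probability may come arbitrarily close to \<open>0\<close> on a compact interval on which it is
  positive, because it is not continuous. Far out this is excluded by comparing \<open>x\<close> with \<open>x - c\<close>
  repeatedly.\<close>

lemma local_prob_bounded_below:
  assumes G: "real_distribution G" and c: "0 < c" and L: "local_prob c G \<in> class_L"
  obtains x1 where "\<And>x2. \<exists>\<delta>>0. \<forall>x\<in>{x1..x2}. \<delta> \<le> local_prob c G x"
proof -
  let ?g = "local_prob c G"
  obtain C x0 where C: "0 < C" "\<And>x s. x0 \<le> x \<Longrightarrow> \<bar>s\<bar> \<le> c \<Longrightarrow> ?g (x - s) \<le> C * ?g x"
    using local_comparison[OF G c L, of c] by blast
  obtain x3 where x3: "\<And>x. x3 \<le> x \<Longrightarrow> 0 < ?g x"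
    using class_L_pos[OF L] by (auto simp: eventually_at_top_linorder)
  define x1 where "x1 = max x0 x3"
  have step: "\<forall>x\<in>{x1..x1 + real k * c}. ?g x1 / C ^ k \<le> ?g x" for k
  proof (induction k)
    case 0
    then show ?case by auto
  next
    case (Suc k)
    show ?case
    proof
      fix x assume x: "x \<in> {x1..x1 + real (Suc k) * c}"
      define y where "y = max x1 (x - c)"
      have "y \<in> {x1..x1 + real k * c}"
        using x c by (auto simp: y_def algebra_simps)
      then have "?g x1 / C ^ k \<le> ?g y" using Suc by blast
      also have "\<dots> \<le> C * ?g x"
        using C(2)[of x "x - y"] x c by (auto simp: y_def x1_def)
      finally show "?g x1 / C ^ Suc k \<le> ?g x"
        using C(1) by (simp add: field_simps)
    qed
  qed
  show thesis
  proof
    fix x2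
    obtain k :: nat where "(x2 - x1) / c \<le> real k"
      using real_arch_simple by blast
    then have "{x1..x2} \<subseteq> {x1..x1 + real k * c}"
      using c by (auto simp: pos_divide_le_eq)
    then show "\<exists>\<delta>>0. \<forall>x\<in>{x1..x2}. \<delta> \<le> ?g x"
      using step[of k] C(1) x3[of x1] by (intro exI[of _ "?g x1 / C ^ k"]) (auto simp: x1_def)
  qed
qed

text \<open>If \<open>X + S\<close> lies in \<open>x + \<Delta>\<close>, with \<open>S\<close> the sum of the other \<open>n\<close> terms, then either \<open>X \<le> x - A\<close>
  or \<open>S \<le> A + c\<close>. In the first case the hypothesis replaces the law of \<open>S\<close> by that of a single
  summand \<open>X'\<close>. If \<open>X + X'\<close> exceeds \<open>x\<close> and \<open>X \<le> x - A\<close>, then \<open>X'\<close> lies outside the window from \<open>-A\<close>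
  to \<open>A\<close>, which accounts for the subtracted integral.\<close>

lemma conv_power_step:
  assumes G: "real_distribution G" and c: "0 < c" and B: "0 \<le> B"
    and bound: "\<And>y. A \<le> y \<Longrightarrow> local_prob c (conv_power G n) y \<le> B * local_prob c G y"
  shows "local_prob c (conv_power G (Suc n)) x \<le>
    B * (local_prob c (G \<star> G) x - (\<integral>s. indicator {-A..A} s * local_prob c G (x - s) \<partial>G)) +
    (\<integral>s. indicator {..A + c} s * local_prob c G (x - s) \<partial>conv_power G n)"
proof -
  interpret real_distribution G by fact
  note Gn = real_distribution_conv_power[OF G, of n]
  have [measurable]: "local_prob c G \<in> borel_measurable borel"
    "local_prob c (conv_power G n) \<in> borel_measurable borel"
    using G Gn c by auto
  have "local_prob c (conv_power G (Suc n)) x = joint_mass c G (conv_power G n) UNIV x"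
    by (simp add: joint_mass_UNIV[OF G Gn])
  also have "\<dots> \<le> joint_mass c G (conv_power G n) ({..x - A} \<times> UNIV \<union> UNIV \<times> {..A + c}) x"
    by (rule joint_mass_mono[OF G Gn]) auto
  also have "\<dots> \<le> joint_mass c G (conv_power G n) ({..x - A} \<times> UNIV) x +
      joint_mass c G (conv_power G n) (UNIV \<times> {..A + c}) x"
    by (rule joint_mass_Un_le[OF G Gn]) auto
  also have "joint_mass c G (conv_power G n) (UNIV \<times> {..A + c}) x =
      (\<integral>s. indicator {..A + c} s * local_prob c G (x - s) \<partial>conv_power G n)"
    by (rule joint_mass_snd[OF G Gn]) simp
  also have "joint_mass c G (conv_power G n) ({..x - A} \<times> UNIV) x \<le>
      B * joint_mass c G G ({..x - A} \<times> UNIV) x"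
  proof -
    have "joint_mass c G (conv_power G n) ({..x - A} \<times> UNIV) x =
        (\<integral>s. indicator {..x - A} s * local_prob c (conv_power G n) (x - s) \<partial>G)"
      by (rule joint_mass_fst[OF G Gn]) simp
    also have "\<dots> \<le> (\<integral>s. B * (indicator {..x - A} s * local_prob c G (x - s)) \<partial>G)"
    proof (rule integral_mono)
      show "integrable G (\<lambda>s. indicator {..x - A} s * local_prob c (conv_power G n) (x - s))"
        by (rule integrable_const_bound[where B = 1])
          (use local_prob_bounds[OF Gn] in \<open>auto simp: indicator_def\<close>)
      have "integrable G (\<lambda>s. indicator {..x - A} s * local_prob c G (x - s))"
        by (rule integrable_const_bound[where B = 1])
          (use local_prob_bounds[OF G] in \<open>auto simp: indicator_def\<close>)
      then show "integrable G (\<lambda>s. B * (indicator {..x - A} s * local_prob c G (x - s)))"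
        by simp
      show "indicator {..x - A} s * local_prob c (conv_power G n) (x - s) \<le>
          B * (indicator {..x - A} s * local_prob c G (x - s))" for s
        using bound[of "x - s"] by (auto simp: indicator_def)
    qed
    also have "\<dots> = B * joint_mass c G G ({..x - A} \<times> UNIV) x"
      by (simp add: joint_mass_fst[OF G G])
    finally show ?thesis .
  qed
  also have "joint_mass c G G ({..x - A} \<times> UNIV) x \<le>
      local_prob c (G \<star> G) x - (\<integral>s. indicator {-A..A} s * local_prob c G (x - s) \<partial>G)"
  proof -
    have "joint_mass c G G ({..x - A} \<times> UNIV) x + joint_mass c G G (UNIV \<times> {-A..A}) x =
        joint_mass c G G ({..x - A} \<times> UNIV \<union> UNIV \<times> {-A..A}) x"
      by (rule joint_mass_Un[symmetric, OF G G]) auto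
    also have "\<dots> \<le> joint_mass c G G UNIV x"
      by (rule joint_mass_mono[OF G G]) auto
    finally show ?thesis by (simp add: joint_mass_UNIV[OF G G] joint_mass_snd[OF G G])
  qed
  finally show ?thesis using B by (simp add: mult_left_mono)
qed

text \<open>The limit is close to \<open>1\<close> for a large window; this is why \<open>conv_power_step\<close> costs only a factor
  \<open>1 + \<epsilon>\<close>.\<close>

lemma outer_mass_limit:
  assumes c: "0 < c" and S: "G \<in> class_S_Delta c"
  shows "((\<lambda>x. (local_prob c (G \<star> G) x - (\<integral>s. indicator {-A..A} s * local_prob c G (x - s) \<partial>G)) /
    local_prob c G x) \<longlongrightarrow> 2 - measure G {-A..A}) at_top"
proof -
  note G = class_S_DeltaD[OF c S]
  have "((\<lambda>x. local_prob c G x / local_prob c G x) \<longlongrightarrow> 1) at_top"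
    using class_L_ratio[OF G(2), of 0] by simp
  from tendsto_diff[OF G(3) window_smear_limit[OF G(1) c G(2) G(1) local_prob_measurable[OF G(1) c] this, of A]]
  show ?thesis by (simp add: diff_divide_distrib)
qed

text \<open>Kesten's bound, uniform in \<open>n\<close> and \<open>x\<close> and with arbitrarily slow exponential growth. It follows by
  iterating \<open>conv_power_step\<close>: the first term multiplies the bound by \<open>1 + e\<close> and the second adds a
  constant independent of \<open>n\<close>.\<close>

lemma kesten_bound:
  assumes c: "0 < c" and S: "G \<in> class_S_Delta c"
    and dom: "almost_decreasing (local_prob c G) \<or> measure G {0..} = 1" and e: "0 < e"
  obtains A B where "\<And>n x. A \<le> x \<Longrightarrow> local_prob c (conv_power G n) x \<le> B * (1 + e) ^ n * local_prob c G x"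
proof -
  note GS = class_S_DeltaD[OF c S]
  note G = GS(1) note L = GS(2)
  note Gn = real_distribution_conv_power[OF G]
  let ?g = "local_prob c G"
  obtain x1 where x1: "\<And>x2. \<exists>\<delta>>0. \<forall>x\<in>{x1..x2}. \<delta> \<le> ?g x"
    using local_prob_bounded_below[OF G c L] by blast
  have "((\<lambda>A. 2 - measure G {-A..A}) \<longlongrightarrow> 2 - 1) at_top"
    by (intro tendsto_intros measure_window_tendsto[OF G])
  then have "\<forall>\<^sub>F A in at_top. 2 - measure G {-A..A} < 1 + e"
    by (rule order_tendstoD) (use e in simp)
  with eventually_ge_at_top[of "max 0 x1"]
  have "\<forall>\<^sub>F A in at_top. max 0 x1 \<le> A \<and> 2 - measure G {-A..A} < 1 + e"
    by (rule eventually_conj)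
  then obtain A where A: "0 \<le> A" "x1 \<le> A" "2 - measure G {-A..A} < 1 + e"
    using eventually_happens'[OF trivial_limit_at_top_linorder] by fastforce
  let ?U = "\<lambda>x. local_prob c (G \<star> G) x - (\<integral>s. indicator {-A..A} s * ?g (x - s) \<partial>G)"
  let ?W = "\<lambda>n x. \<integral>s. indicator {..A + c} s * ?g (x - s) \<partial>conv_power G n"
  obtain C x3 where C: "0 < C" "\<And>n. AE s in conv_power G n. s \<in> {..A + c} \<longrightarrow>
    (\<forall>x\<ge>x3. ?g (x - s) \<le> C * ?g x)"
    using left_window_domination[OF G c L dom, of "A + c"] by blast
  have "\<forall>\<^sub>F x in at_top. ?U x / ?g x < 1 + e"
    using outer_mass_limit[OF c S] A(3) by (rule order_tendstoD)
  then have "\<forall>\<^sub>F x in at_top. ?U x \<le> (1 + e) * ?g x"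
    using class_L_pos[OF L] by eventually_elim (simp add: field_simps)
  then obtain x4 where x4: "\<And>x. x4 \<le> x \<Longrightarrow> ?U x \<le> (1 + e) * ?g x"
    by (auto simp: eventually_at_top_linorder)
  have W: "?W n x \<le> C * ?g x" if x: "x3 \<le> x" for n x
  proof -
    interpret real_distribution "conv_power G n" by (rule Gn)
    have [measurable]: "?g \<in> borel_measurable borel" using G c by auto
    have "?W n x \<le> (\<integral>s. C * ?g x \<partial>conv_power G n)"
    proof (rule integral_mono_AE)
      show "integrable (conv_power G n) (\<lambda>s. indicator {..A + c} s * ?g (x - s))"
        by (rule integrable_const_bound[where B = 1])
          (use local_prob_bounds[OF G] in \<open>auto simp: indicator_def\<close>)
      show "AE s in conv_power G n. indicator {..A + c} s * ?g (x - s) \<le> C * ?g x"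
        using C(2)[of n]
        by eventually_elim
          (use x C(1) local_prob_bounds(1)[OF G, of c x] in \<open>auto simp: indicator_def\<close>)
    qed simp
    then show ?thesis using prob_space by simp
  qed
  define x2 where "x2 = max x3 x4"
  obtain \<delta> where d: "0 < \<delta>" "\<And>x. x \<in> {A..x2} \<Longrightarrow> \<delta> \<le> ?g x"
    using x1[of x2] A(2) by auto
  \<comment> \<open>Beyond \<open>x2\<close> the additive constant \<open>C\<close> suffices; between \<open>A\<close> and \<open>x2\<close> the trivial bound \<open>1\<close> costs \<open>1 / \<delta>\<close>.\<close>
  define D where "D = C + 1 / \<delta>"
  have D: "0 < D" "C \<le> D" "1 / \<delta> \<le> D"
    using C(1) d(1) by (auto simp: D_def add_pos_pos)
  \<comment> \<open>The solution of the recursion \<open>b (Suc n) = (1 + e) * b n + D\<close> with \<open>b 0 = 0\<close>.\<close>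
  define b where "b n = D / e * ((1 + e) ^ n - 1)" for n
  have b0: "0 \<le> b n" for n
    using D e by (simp add: b_def one_le_power)
  have bS: "b (Suc n) = b n * (1 + e) + D" for n
    using e by (simp add: b_def field_simps)
  have main: "\<forall>x\<ge>A. local_prob c (conv_power G n) x \<le> b n * ?g x" for n
  proof (induction n)
    case 0
    have "local_prob c (return borel 0) x = 0" if "A \<le> x" for x
      using that A(1) by (simp add: local_prob_def measure_return)
    then show ?case by (simp add: b_def)
  next
    case (Suc n)
    show ?case
    proof (intro allI impI)
      fix x assume x: "A \<le> x"
      have g0: "0 \<le> ?g x" using local_prob_bounds(1)[OF G] .
      show "local_prob c (conv_power G (Suc n)) x \<le> b (Suc n) * ?g x"
      proof (cases "x2 \<le> x")
        case True
        have "local_prob c (conv_power G (Suc n)) x \<le> b n * ?U x + ?W n x"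
          by (rule conv_power_step[OF G c b0]) (use Suc in blast)
        also have "\<dots> \<le> b n * ((1 + e) * ?g x) + C * ?g x"
          using True by (intro add_mono mult_left_mono x4 W b0) (auto simp: x2_def)
        also have "\<dots> \<le> b n * ((1 + e) * ?g x) + D * ?g x"
          using D(2) g0 by (simp add: mult_right_mono)
        finally show ?thesis by (simp add: bS algebra_simps)
      next
        case False
        then have "\<delta> \<le> ?g x" using x by (intro d(2)) auto
        have "local_prob c (conv_power G (Suc n)) x \<le> 1"
          by (rule local_prob_bounds(2)[OF Gn])
        also have "1 \<le> 1 / \<delta> * ?g x"
          using \<open>\<delta> \<le> ?g x\<close> d(1) by (simp add: field_simps)
        also have "\<dots> \<le> b (Suc n) * ?g x"
          using D(3) e b0[of n] by (intro mult_right_mono g0) (simp add: bS add_increasing)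
        finally show ?thesis .
      qed
    qed
  qed
  show thesis
  proof
    fix n x assume "A \<le> x"
    then have "local_prob c (conv_power G n) x \<le> b n * ?g x" using main by blast
    also have "\<dots> \<le> D / e * (1 + e) ^ n * ?g x"
      using D(1) e local_prob_bounds(1)[OF G, of c x]
      by (intro mult_right_mono) (auto simp: b_def divide_right_mono)
    finally show "local_prob c (conv_power G n) x \<le> D / e * (1 + e) ^ n * ?g x" .
  qed
qed

lemma conv_power_liminf:
  assumes G: "real_distribution G" and c: "0 < c" and L: "local_prob c G \<in> class_L" and e: "0 < e"
  shows "\<forall>\<^sub>F x in at_top. (real n - e) * local_prob c G x \<le> local_prob c (conv_power G n) x"
  using e
proof (induction n arbitrary: e)
  case 0
  have "(real 0 - e) * local_prob c G x \<le> local_prob c (conv_power G 0) x" for x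
  proof -
    have "(real 0 - e) * local_prob c G x \<le> 0"
      using 0 local_prob_bounds(1)[OF G, of c x] by (simp add: mult_nonneg_nonneg)
    then show ?thesis
      using local_prob_bounds(1)[OF real_distribution_conv_power[OF G], of c 0 x] by linarith
  qed
  then show ?case by (intro always_eventually allI)
next
  case (Suc n)
  have "\<forall>\<^sub>F x in at_top. (1 + real n - e) * local_prob c G x \<le> local_prob c (G \<star> conv_power G n) x"
  proof (rule local_prob_convolution_liminf[OF G c L G real_distribution_conv_power[OF G]])
    show "\<forall>\<^sub>F x in at_top. (1 - d) * local_prob c G x \<le> local_prob c G x" if "0 < d" for d
      using that local_prob_bounds(1)[OF G, of c] by (intro always_eventually allI) (simp add: algebra_simps)
  qed (use Suc in auto)
  then show ?case by (simp add: add.commute)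
qed

text \<open>The lower bound is the Fatou bound. For the upper bound, the first term of \<open>conv_power_step\<close> tends
  to at most \<open>n\<close> and the second to at most \<open>1\<close> as the window grows.\<close>

lemma conv_power_ratio:
  assumes c: "0 < c" and S: "G \<in> class_S_Delta c"
    and dom: "almost_decreasing (local_prob c G) \<or> measure G {0..} = 1"
  shows "((\<lambda>x. local_prob c (conv_power G n) x / local_prob c G x) \<longlongrightarrow> real n) at_top"
proof (induction n)
  case 0
  have "\<forall>\<^sub>F x in at_top. 0 = local_prob c (conv_power G 0) x / local_prob c G x"
    using eventually_ge_at_top[of 0]
    by eventually_elim (simp add: local_prob_def measure_return)
  from Lim_transform_eventually[OF tendsto_const this] show ?case by simp
next
  case (Suc n)
  note GS = class_S_DeltaD[OF c S]
  note G = GS(1) note L = GS(2)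
  let ?g = "local_prob c G"
  have [measurable]: "?g \<in> borel_measurable borel" using G c by auto
  show ?case
  proof (rule order_tendstoI)
    fix a assume a: "a < real (Suc n)"
    define e where "e = (real (Suc n) - a) / 2"
    have "0 < e" using a by (simp add: e_def)
    have "a < real (Suc n) - e" using a by (simp add: e_def field_simps)
    show "\<forall>\<^sub>F x in at_top. a < local_prob c (conv_power G (Suc n)) x / ?g x"
      using conv_power_liminf[OF G c L \<open>0 < e\<close>, of "Suc n"] class_L_pos[OF L]
    proof eventually_elim
      case (elim x)
      then have "real (Suc n) - e \<le> local_prob c (conv_power G (Suc n)) x / ?g x"
        by (simp add: pos_le_divide_eq)
      then show ?case using \<open>a < real (Suc n) - e\<close> by linarith
    qed
  next
    fix a assume a: "real (Suc n) < a"
    \<comment> \<open>Small enough that \<open>(real n + \<eta>) * (1 + \<eta>) + 1 < a\<close>.\<close>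
    define \<eta> where "\<eta> = min 1 ((a - real (Suc n)) / (real n + 3))"
    have eta: "0 < \<eta>" "\<eta> \<le> 1" using a by (auto simp: \<eta>_def)
    have "\<eta> * (real n + 3) \<le> a - real (Suc n)"
      by (simp add: \<eta>_def min_mult_distrib_right)
    moreover have "(real n + \<eta>) * (1 + \<eta>) + 1 < real (Suc n) + \<eta> * (real n + 3)"
    proof -
      have "\<eta> * \<eta> \<le> \<eta>" using eta by (simp add: mult_left_le)
      then show ?thesis using eta by (simp add: algebra_simps)
    qed
    ultimately have eta_a: "(real n + \<eta>) * (1 + \<eta>) + 1 < a" by linarith
    have "\<forall>\<^sub>F x in at_top. local_prob c (conv_power G n) x / ?g x < real n + \<eta>"
      using Suc by (rule order_tendstoD) (use eta in simp)
    then have "\<forall>\<^sub>F x in at_top. local_prob c (conv_power G n) x \<le> (real n + \<eta>) * ?g x"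
      using class_L_pos[OF L] by eventually_elim (simp add: field_simps)
    then obtain y0 where y0: "\<And>y. y0 \<le> y \<Longrightarrow> local_prob c (conv_power G n) y \<le> (real n + \<eta>) * ?g y"
      by (auto simp: eventually_at_top_linorder)
    have "((\<lambda>A. 2 - measure G {-A..A}) \<longlongrightarrow> 2 - 1) at_top"
      by (intro tendsto_intros measure_window_tendsto[OF G])
    then have "\<forall>\<^sub>F A in at_top. 2 - measure G {-A..A} < 1 + \<eta>"
      by (rule order_tendstoD) (use eta in simp)
    with eventually_ge_at_top[of y0]
    have "\<forall>\<^sub>F A in at_top. y0 \<le> A \<and> 2 - measure G {-A..A} < 1 + \<eta>"
      by (rule eventually_conj)
    then obtain A where A: "y0 \<le> A" "2 - measure G {-A..A} < 1 + \<eta>"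
      using eventually_happens'[OF trivial_limit_at_top_linorder] by blast
    let ?U = "\<lambda>x. local_prob c (G \<star> G) x - (\<integral>s. indicator {-A..A} s * ?g (x - s) \<partial>G)"
    let ?W = "\<lambda>x. \<integral>s. indicator {..A + c} s * ?g (x - s) \<partial>conv_power G n"
    obtain C x3 where C: "0 < C" "\<And>n. AE s in conv_power G n. s \<in> {..A + c} \<longrightarrow>
      (\<forall>x\<ge>x3. ?g (x - s) \<le> C * ?g x)"
      using left_window_domination[OF G c L dom, of "A + c"] by blast
    have W: "((\<lambda>x. ?W x / ?g x) \<longlongrightarrow> 1 * measure (conv_power G n) {..A + c}) at_top"
    proof (rule restricted_smear_limit[OF real_distribution_conv_power[OF G] L, where C = C])
      show "((\<lambda>x. ?g x / ?g x) \<longlongrightarrow> 1) at_top"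
        using class_L_ratio[OF L, of 0] by simp
      show "AE s in conv_power G n. s \<in> {..A + c} \<longrightarrow> (\<forall>x\<ge>x3. \<bar>?g (x - s)\<bar> \<le> C * ?g x)"
        using C(2)[of n] by eventually_elim (simp add: abs_of_nonneg local_prob_bounds(1)[OF G])
    qed simp_all
    have "((\<lambda>x. (real n + \<eta>) * (?U x / ?g x) + ?W x / ?g x) \<longlongrightarrow>
        (real n + \<eta>) * (2 - measure G {-A..A}) + 1 * measure (conv_power G n) {..A + c}) at_top"
      by (intro tendsto_add tendsto_mult tendsto_const outer_mass_limit[OF c S] W)
    moreover have "(real n + \<eta>) * (2 - measure G {-A..A}) + 1 * measure (conv_power G n) {..A + c} < a"
    proof -
      have "(real n + \<eta>) * (2 - measure G {-A..A}) \<le> (real n + \<eta>) * (1 + \<eta>)"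
        using A(2) eta by (intro mult_left_mono) auto
      moreover have "measure (conv_power G n) {..A + c} \<le> 1"
        by (rule prob_space.prob_le_1[OF real_distribution_facts(2)[OF real_distribution_conv_power[OF G]]])
      ultimately show ?thesis using eta_a by simp
    qed
    ultimately have "\<forall>\<^sub>F x in at_top. (real n + \<eta>) * (?U x / ?g x) + ?W x / ?g x < a"
      by (rule order_tendstoD)
    then show "\<forall>\<^sub>F x in at_top. local_prob c (conv_power G (Suc n)) x / ?g x < a"
      using class_L_pos[OF L]
    proof eventually_elim
      case (elim x)
      have "local_prob c (conv_power G (Suc n)) x \<le> (real n + \<eta>) * ?U x + ?W x"
        by (rule conv_power_step[OF G c]) (use eta y0 A in auto)
      then have "local_prob c (conv_power G (Suc n)) x / ?g x \<le> ((real n + \<eta>) * ?U x + ?W x) / ?g x"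
        using elim by (intro divide_right_mono) auto
      then show ?case using elim by (simp add: add_divide_distrib)
    qed
  qed
qed

section \<open>From the summand to the compound distribution\<close>

lemma neg_binomial_weight_Suc:
  assumes "0 < a" "0 < q" "q < 1"
  shows "real (Suc n) * neg_binomial_weight a q (Suc n) = a * q / (1 - q) * neg_binomial_weight (a + 1) q n"
  using assms
  by (simp add: neg_binomial_weight_pochhammer pochhammer_rec powr_add field_simps del: of_nat_Suc)

lemma neg_binomial_mean:
  assumes "0 < a" "0 < q" "q < 1"
  shows "(\<lambda>n. real n * neg_binomial_weight a q n) sums (a * q / (1 - q))"
proof -
  have "(\<lambda>n. a * q / (1 - q) * neg_binomial_weight (a + 1) q n) sums (a * q / (1 - q) * 1)"
    by (intro sums_mult neg_binomial_weight_sums) (use assms in auto)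
  then have "(\<lambda>n. real (Suc n) * neg_binomial_weight a q (Suc n)) sums (a * q / (1 - q))"
    by (simp only: neg_binomial_weight_Suc[OF assms] mult_1_right)
  from sums_Suc[OF this] show ?thesis by simp
qed

text \<open>Dominated convergence for the series over \<open>n\<close>: each term has the limit given by
  \<open>conv_power_ratio\<close>, and Kesten's bound with \<open>q * (1 + e) < 1\<close> provides a summable majorant.\<close>

lemma compound_ratio:
  assumes c: "0 < c" and a: "0 < a" and q: "0 < q" "q < 1" and S: "G \<in> class_S_Delta c"
    and dom: "almost_decreasing (local_prob c G) \<or> measure G {0..} = 1"
  shows "((\<lambda>x. local_prob c (compound_neg_binomial a q G) x / local_prob c G x)
    \<longlongrightarrow> a * q / (1 - q)) at_top"
proof -
  note G = class_S_DeltaD(1)[OF c S] and L = class_S_DeltaD(2)[OF c S]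
  let ?w = "neg_binomial_weight a q"
  let ?t = "\<lambda>n x. ?w n * (local_prob c (conv_power G n) x / local_prob c G x)"
  \<comment> \<open>With this \<open>e\<close> the product \<open>q * (1 + e)\<close> is the midpoint of \<open>q\<close> and \<open>1\<close>.\<close>
  define e where "e = (1 / q - 1) / 2"
  have e: "0 < e" using q by (simp add: e_def field_simps)
  have qe: "0 < q * (1 + e)" "q * (1 + e) < 1"
    using q e by (simp_all only: mult_pos_pos add_pos_pos zero_less_one) (simp add: e_def field_simps)
  obtain A B where AB: "\<And>n x. A \<le> x \<Longrightarrow>
      local_prob c (conv_power G n) x \<le> B * (1 + e) ^ n * local_prob c G x"
    using kesten_bound[OF c S dom e] by blast
  have "?w n * (B * (1 + e) ^ n) =
      B * ((1 - q) powr a / (1 - q * (1 + e)) powr a) * neg_binomial_weight a (q * (1 + e)) n" for n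
    using a qe by (simp add: neg_binomial_weight_pochhammer power_mult_distrib)
  then have sum: "summable (\<lambda>n. ?w n * (B * (1 + e) ^ n))"
    using summable_mult[OF sums_summable[OF neg_binomial_weight_sums[OF a qe]]] by (simp only:)
  obtain x0 where x0: "\<And>x. x0 \<le> x \<Longrightarrow> 0 < local_prob c G x"
    using class_L_pos[OF L] unfolding eventually_at_top_linorder by blast
  have "norm (?t n x) \<le> ?w n * (B * (1 + e) ^ n)" if "max A x0 \<le> x" for n x
  proof -
    have p: "0 \<le> local_prob c (conv_power G n) x" and w: "0 \<le> ?w n"
      using local_prob_bounds(1)[OF real_distribution_conv_power[OF G]] neg_binomial_weight_nonneg[OF a q]
      by auto
    have g: "0 < local_prob c G x" using x0[of x] that by simp
    have "local_prob c (conv_power G n) x / local_prob c G x \<le> B * (1 + e) ^ n"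
      using AB[of x n] that g by (simp add: pos_divide_le_eq)
    then have "?t n x \<le> ?w n * (B * (1 + e) ^ n)" using w by (rule mult_left_mono)
    then show ?thesis using p w g by simp
  qed
  then have "\<forall>\<^sub>F (n, x) in at_top \<times>\<^sub>F at_top. norm (?t n x) \<le> ?w n * (B * (1 + e) ^ n)"
    unfolding eventually_prod_filter
    by (intro exI[of _ "\<lambda>_. True"] exI[of _ "\<lambda>x. max A x0 \<le> x"] conjI)
      (simp, simp only: eventually_ge_at_top, blast)
  then have "((\<lambda>x. \<Sum>n. ?t n x) \<longlongrightarrow> (\<Sum>n. ?w n * real n)) at_top"
    using tannerys_theorem[of ?t "\<lambda>n. ?w n * real n" at_top, OF _ _ sum]
      tendsto_mult[OF tendsto_const conv_power_ratio[OF c S dom]] by simp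
  moreover have "(\<Sum>n. ?t n x) = local_prob c (compound_neg_binomial a q G) x / local_prob c G x" for x
    using sums_divide[OF local_prob_compound_sums[OF G a q, of c x], of "local_prob c G x"]
    by (simp add: sums_iff)
  moreover have "(\<Sum>n. ?w n * real n) = a * q / (1 - q)"
    using neg_binomial_mean[OF a q] by (simp add: sums_iff mult.commute)
  ultimately show ?thesis by simp
qed

text \<open>The convolution square has parameter \<open>2 a\<close>, so both it and the compound distribution itself are
  asymptotic to known multiples of the local probability of \<open>G\<close>, the first multiple being twice the
  second.\<close>

lemma class_S_Delta_compound:
  assumes c: "0 < c" and a: "0 < a" and q: "0 < q" "q < 1" and S: "G \<in> class_S_Delta c"
    and dom: "almost_decreasing (local_prob c G) \<or> measure G {0..} = 1"
  shows "compound_neg_binomial a q G \<in> class_S_Delta c"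
proof (rule class_S_DeltaI)
  note G = class_S_DeltaD(1)[OF c S] and L = class_S_DeltaD(2)[OF c S]
  let ?F = "compound_neg_binomial a q G"
  let ?k = "a * q / (1 - q)"
  show F: "real_distribution ?F"
    by (rule real_distribution_compound_neg_binomial[OF G a q])
  have k: "0 < ?k" using a q by simp
  note R = compound_ratio[OF c a q S dom]
  show "local_prob c ?F \<in> class_L"
    by (rule class_L_transfer[OF L _ _ R k]) (use F c local_prob_bounds in auto)
  have FF: "(?F \<star> ?F) = compound_neg_binomial (a + a) q G"
    by (rule compound_convolution[OF G a a q])
  have "((\<lambda>x. (local_prob c (?F \<star> ?F) x / local_prob c G x) / (local_prob c ?F x / local_prob c G x))
      \<longlongrightarrow> ((a + a) * q / (1 - q)) / ?k) at_top"
    unfolding FF by (intro tendsto_divide compound_ratio[OF c _ q S dom] R) (use a k in auto)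
  also have "((a + a) * q / (1 - q)) / ?k = 2"
    using a q by (simp add: field_simps)
  finally show "((\<lambda>x. local_prob c (?F \<star> ?F) x / local_prob c ?F x) \<longlongrightarrow> 2) at_top"
    by (rule Lim_transform_eventually)
      (use class_L_pos[OF L] in \<open>eventually_elim, simp\<close>)
qed

text \<open>The Fatou bounds for the terms of the series already add up to the assumed limit of the whole
  series. No term can exceed its bound in the limit, and the term \<open>n = 2\<close> has positive weight.\<close>

lemma class_S_Delta_if_compound_ratio:
  assumes c: "0 < c" and a: "0 < a" and q: "0 < q" "q < 1"
    and G: "real_distribution G" and L: "local_prob c G \<in> class_L"
    and R: "((\<lambda>x. local_prob c (compound_neg_binomial a q G) x / local_prob c G x)
      \<longlongrightarrow> a * q / (1 - q)) at_top"
  shows "G \<in> class_S_Delta c"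
proof (rule class_S_DeltaI[OF G L])
  let ?F = "compound_neg_binomial a q G" and ?g = "local_prob c G"
  let ?w = "neg_binomial_weight a q"
  let ?k = "a * q / (1 - q)"
  have w0: "0 \<le> ?w n" for n by (rule neg_binomial_weight_nonneg[OF a q])
  have w2: "0 < ?w 2" by (rule neg_binomial_weight_pos[OF a q])
  have GG: "(G \<star> G) = conv_power G 2" by (rule conv_power_2[OF G, symmetric])
  show "((\<lambda>x. local_prob c (G \<star> G) x / ?g x) \<longlongrightarrow> 2) at_top"
    unfolding GG
  proof (rule tendstoI)
    fix d :: real assume d: "0 < d"
    \<comment> \<open>Three errors of size \<open>\<eta>\<close> arise below, and they are divided by the weight of the term \<open>n = 2\<close>.\<close>
    define \<eta> where "\<eta> = d * ?w 2 / 4"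
    have eta: "0 < \<eta>" using d w2 by (simp add: \<eta>_def)
    have "(\<lambda>N. \<Sum>n<N. real n * ?w n) \<longlonglongrightarrow> ?k"
      using neg_binomial_mean[OF a q] by (simp add: sums_def)
    then have "\<forall>\<^sub>F N in sequentially. ?k - \<eta> < (\<Sum>n<N. real n * ?w n)"
      by (rule order_tendstoD) (use eta in simp)
    with eventually_ge_at_top[of 3]
    have "\<forall>\<^sub>F N in sequentially. 3 \<le> N \<and> ?k - \<eta> < (\<Sum>n<N. real n * ?w n)"
      by (rule eventually_conj)
    then obtain N where N: "3 \<le> N" "?k - \<eta> < (\<Sum>n<N. real n * ?w n)"
      using eventually_happens'[OF trivial_limit_sequentially] by blast
    have sum1: "(\<Sum>n\<in>{..<N} - {2}. ?w n) \<le> 1"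
      using sum_le_suminf[OF sums_summable[OF neg_binomial_weight_sums[OF a q]], of "{..<N} - {2}"]
        sums_unique[OF neg_binomial_weight_sums[OF a q]] w0 by simp
    have "\<forall>\<^sub>F x in at_top. \<forall>n\<in>{..<N}. (real n - \<eta>) * ?g x \<le> local_prob c (conv_power G n) x"
      by (intro eventually_ball_finite ballI conv_power_liminf[OF G c L eta]) simp
    moreover have "\<forall>\<^sub>F x in at_top. (real 2 - d / 2) * ?g x \<le> local_prob c (conv_power G 2) x"
      by (rule conv_power_liminf[OF G c L]) (use d in simp)
    moreover have "\<forall>\<^sub>F x in at_top. local_prob c ?F x / ?g x < ?k + \<eta>"
      using R by (rule order_tendstoD) (use eta in simp)
    ultimately show "\<forall>\<^sub>F x in at_top. dist (local_prob c (conv_power G 2) x / ?g x) 2 < d"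
      using class_L_pos[OF L]
    proof eventually_elim
      case (elim x)
      let ?p = "\<lambda>n. local_prob c (conv_power G n) x"
      have g: "0 < ?g x" by fact
      have p0: "0 \<le> ?p n" for n
        by (rule local_prob_bounds(1)[OF real_distribution_conv_power[OF G]])
      have split: "(\<Sum>n<N. u n) = u 2 + (\<Sum>n\<in>{..<N} - {2}. u n)" for u :: "nat \<Rightarrow> real"
        using N(1) by (intro sum.remove) auto
      have "(\<Sum>n<N. ?w n * ?p n) \<le> local_prob c ?F x"
        using sum_le_suminf[OF sums_summable[OF local_prob_compound_sums[OF G a q, of c x]], of "{..<N}"]
          sums_unique[OF local_prob_compound_sums[OF G a q, of c x]] w0 p0 by simp
      then have "?w 2 * ?p 2 + (\<Sum>n\<in>{..<N} - {2}. ?w n * ?p n) \<le> local_prob c ?F x"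
        by (simp only: split)
      moreover have "local_prob c ?F x \<le> (?k + \<eta>) * ?g x"
        using elim(3) g by (simp add: pos_divide_less_eq)
      moreover have "(\<Sum>n\<in>{..<N} - {2}. ?w n * ((real n - \<eta>) * ?g x)) \<le> (\<Sum>n\<in>{..<N} - {2}. ?w n * ?p n)"
        using elim(1) by (intro sum_mono mult_left_mono w0) auto
      moreover have "(\<Sum>n\<in>{..<N} - {2}. ?w n * ((real n - \<eta>) * ?g x)) =
          ((\<Sum>n\<in>{..<N} - {2}. real n * ?w n) - \<eta> * (\<Sum>n\<in>{..<N} - {2}. ?w n)) * ?g x"
        by (simp add: sum_distrib_left sum_distrib_right sum_subtractf[symmetric] algebra_simps)
      moreover have "(?k - \<eta> - 2 * ?w 2 - \<eta>) * ?g x \<le>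
          ((\<Sum>n\<in>{..<N} - {2}. real n * ?w n) - \<eta> * (\<Sum>n\<in>{..<N} - {2}. ?w n)) * ?g x"
      proof (rule mult_right_mono)
        have "\<eta> * (\<Sum>n\<in>{..<N} - {2}. ?w n) \<le> \<eta>" using sum1 eta by (simp add: mult_left_le)
        then show "?k - \<eta> - 2 * ?w 2 - \<eta> \<le>
            (\<Sum>n\<in>{..<N} - {2}. real n * ?w n) - \<eta> * (\<Sum>n\<in>{..<N} - {2}. ?w n)"
          using N(2) split[of "\<lambda>n. real n * ?w n"] by simp
      qed (use g in simp)
      ultimately have "?w 2 * ?p 2 \<le> (?k + \<eta>) * ?g x - (?k - \<eta> - 2 * ?w 2 - \<eta>) * ?g x"
        by linarith
      also have "\<dots> = ?w 2 * ((2 + 3 / 4 * d) * ?g x)"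
        by (simp add: \<eta>_def algebra_simps)
      finally have "?p 2 / ?g x \<le> 2 + 3 / 4 * d"
        using w2 g by (simp add: pos_divide_le_eq)
      moreover have "2 - d / 2 \<le> ?p 2 / ?g x"
        using elim(2) g by (simp add: pos_le_divide_eq)
      ultimately show ?case using d by (simp add: dist_real_def abs_less_iff)
    qed
  qed
qed

section \<open>Local asymptotics as a derivation\<close>

lemma emeasure_le_of_measure_le:
  assumes M: "real_distribution M" and F: "real_distribution F" and C: "0 \<le> C"
    and le: "\<And>B. measure M B \<le> C * measure F B"
  shows "emeasure M B \<le> ennreal C * emeasure F B"
  using le[of B] C
  by (simp add: finite_measure.emeasure_eq_measure[OF real_distribution_facts(1)[OF M]]
      finite_measure.emeasure_eq_measure[OF real_distribution_facts(1)[OF F]]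
      ennreal_mult[symmetric] ennreal_leI)

lemma nn_integral_dominated:
  assumes M: "real_distribution M" and F: "real_distribution F" and C: "0 \<le> C"
    and le: "\<And>B. measure M B \<le> C * measure F B"
    and h [measurable]: "h \<in> borel_measurable borel"
  shows "(\<integral>\<^sup>+s. h s \<partial>M) \<le> ennreal C * (\<integral>\<^sup>+s. h s \<partial>F)"
proof -
  note [simp] = real_distribution_facts[OF M] real_distribution_facts[OF F]
  have "(\<integral>\<^sup>+s. h s \<partial>M) \<le> (\<integral>\<^sup>+s. h s \<partial>scale_measure (ennreal C) F)"
  proof (rule nn_integral_mono_measure)
    show "sets M = sets (scale_measure (ennreal C) F)" by simp
    show "M \<le> scale_measure (ennreal C) F"
      using emeasure_le_of_measure_le[OF M F C le]
      by (subst le_measure) simp_all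
  qed
  also have "\<dots> = ennreal C * (\<integral>\<^sup>+s. h s \<partial>F)"
    using h by (intro nn_integral_scale_measure) (simp add: measurable_cong_sets[OF real_distribution_facts(4)[OF F] refl])
  finally show ?thesis .
qed

lemma pair_measure_dominated:
  assumes M: "real_distribution M" and N: "real_distribution N" and F: "real_distribution F"
    and C: "0 \<le> C" "0 \<le> D"
    and le: "\<And>B. measure M B \<le> C * measure F B" "\<And>B. measure N B \<le> D * measure F B"
    and E [measurable]: "E \<in> sets (borel \<Otimes>\<^sub>M borel)"
  shows "measure (M \<Otimes>\<^sub>M N) E \<le> C * D * measure (F \<Otimes>\<^sub>M F) E"
proof -
  interpret F: real_distribution F by fact
  interpret N: real_distribution N by fact
  note fin = finite_measure.emeasure_eq_measure[OF finite_measure_pair_real_distribution]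
  have "emeasure (M \<Otimes>\<^sub>M N) E = (\<integral>\<^sup>+x. \<integral>\<^sup>+y. indicator E (x, y) \<partial>N \<partial>M)"
    using E sets_pair_real_distribution[OF M N] by (intro N.emeasure_pair_measure) metis
  also have "\<dots> \<le> (\<integral>\<^sup>+x. ennreal D * (\<integral>\<^sup>+y. indicator E (x, y) \<partial>F) \<partial>M)"
    by (intro nn_integral_mono nn_integral_dominated N F C le) measurable
  also have "\<dots> \<le> ennreal C * (\<integral>\<^sup>+x. ennreal D * (\<integral>\<^sup>+y. indicator E (x, y) \<partial>F) \<partial>F)"
    by (intro nn_integral_dominated M F C le) measurable
  also have "\<dots> = ennreal C * (ennreal D * (\<integral>\<^sup>+x. \<integral>\<^sup>+y. indicator E (x, y) \<partial>F \<partial>F))"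
    by (subst nn_integral_cmult) measurable
  also have "(\<integral>\<^sup>+x. \<integral>\<^sup>+y. indicator E (x, y) \<partial>F \<partial>F) = emeasure (F \<Otimes>\<^sub>M F) E"
    using E sets_pair_real_distribution[OF F F] by (intro F.emeasure_pair_measure[symmetric]) metis
  finally show ?thesis
    using C by (simp add: fin[OF M N] fin[OF F F] ennreal_mult[symmetric] mult.assoc)
qed

lemma window_translation_error:
  assumes F: "real_distribution F" and c: "0 < c" and L: "local_prob c F \<in> class_L"
    and N: "real_distribution N"
  shows "((\<lambda>x. \<integral>s. indicator {-A..A} s * \<bar>local_prob c F (x - s) / local_prob c F x - 1\<bar> \<partial>N)
    \<longlongrightarrow> 0) at_top"
proof -
  interpret real_distribution N by fact
  let ?f = "local_prob c F"
  have [measurable]: "?f \<in> borel_measurable borel" using F c by auto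
  obtain C x1 where C: "0 < C" "\<And>x s. x1 \<le> x \<Longrightarrow> \<bar>s\<bar> \<le> A \<Longrightarrow> ?f (x - s) \<le> C * ?f x"
    using local_comparison[OF F c L, of A] by blast
  have "((\<lambda>x. \<integral>s. indicator {-A..A} s * \<bar>?f (x - s) / ?f x - 1\<bar> \<partial>N) \<longlongrightarrow> (\<integral>s. 0 \<partial>N)) at_top"
  proof (rule integral_dominated_convergence_at_top[where w = "\<lambda>_. C + 1"])
    have "((\<lambda>x. indicator {-A..A} s * \<bar>?f (x + - s) / ?f x - 1\<bar>) \<longlongrightarrow> indicator {-A..A} s * \<bar>1 - 1\<bar>) at_top" for s
      by (intro tendsto_intros class_L_ratio[OF L])
    then show "AE s in N. ((\<lambda>x. indicator {-A..A} s * \<bar>?f (x - s) / ?f x - 1\<bar>) \<longlongrightarrow> 0) at_top"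
      by simp
    show "\<forall>\<^sub>F x in at_top. AE s in N. norm (indicator {-A..A} s * \<bar>?f (x - s) / ?f x - 1\<bar>) \<le> C + 1"
      using eventually_ge_at_top[of x1] class_L_pos[OF L]
    proof eventually_elim
      case (elim x)
      have "\<bar>?f (x - s) / ?f x - 1\<bar> \<le> C + 1" if "s \<in> {-A..A}" for s
      proof -
        have "?f (x - s) / ?f x \<le> C" "0 \<le> ?f (x - s) / ?f x"
          using C(2)[of x s] that elim local_prob_bounds(1)[OF F, of c "x - s"]
          by (auto simp: pos_divide_le_eq)
        then show ?thesis by linarith
      qed
      then show ?case using C(1) by (intro AE_I2) (auto simp: indicator_def)
    qed
  qed auto
  then show ?thesis by simp
qed

text \<open>If \<open>M\<close> and \<open>N\<close> are dominated by \<open>F\<close>, then passing to local probabilities relative to those of \<open>F\<close>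
  at infinity behaves like a derivation with respect to convolution. A large sum of two
  independent terms has one term in a fixed window, up to an error: by domination it is at
  most a constant times the mass of the corresponding event for two copies of \<open>F\<close>, and there
  subexponentiality makes it small. When one term \<open>s\<close> lies in the window, the local
  probability of \<open>F\<close> at \<open>x\<close> may be replaced by that at \<open>x - s\<close>. The local probabilities
  of \<open>M\<close> and \<open>N\<close> relative to those of \<open>F\<close> may oscillate, so the product rule compares functions and
  not limits.\<close>

lemma convolution_derivation:
  assumes c: "0 < c" and S: "F \<in> class_S_Delta c"
    and M: "real_distribution M" and N: "real_distribution N" and C: "0 \<le> C" "0 \<le> D"
    and le: "\<And>B. measure M B \<le> C * measure F B" "\<And>B. measure N B \<le> D * measure F B"
  shows "((\<lambda>x. local_prob c (M \<star> N) x / local_prob c F x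
      - smear N (\<lambda>x. local_prob c M x / local_prob c F x) x
      - smear M (\<lambda>x. local_prob c N x / local_prob c F x) x) \<longlongrightarrow> 0) at_top"
    (is "(?D \<longlongrightarrow> 0) at_top")
proof -
  note F = class_S_DeltaD(1)[OF c S] and L = class_S_DeltaD(2)[OF c S]
  let ?f = "local_prob c F"
  let ?err = "\<lambda>P A x. \<integral>s. indicator {-A..A} s * \<bar>?f (x - s) / ?f x - 1\<bar> \<partial>P"
  let ?out = "\<lambda>A. {p :: real \<times> real. A < \<bar>fst p\<bar> \<and> A < \<bar>snd p\<bar>}"
  have out_sets: "?out A \<in> sets (borel \<Otimes>\<^sub>M borel)" for A
  proof -
    have "{p \<in> space (borel \<Otimes>\<^sub>M borel). A < \<bar>fst p :: real\<bar> \<and> A < \<bar>snd p :: real\<bar>} \<in> sets (borel \<Otimes>\<^sub>M borel)"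
      by measurable
    then show ?thesis by (simp add: space_pair_measure)
  qed
  have f0: "0 \<le> ?f x" for x by (rule local_prob_bounds(1)[OF F])
  have decomp: "local_prob c (P \<star> Q) x =
      (\<integral>s. indicator {-A..A} s * local_prob c P (x - s) \<partial>Q) +
      (\<integral>s. indicator {-A..A} s * local_prob c Q (x - s) \<partial>P) + joint_mass c P Q (?out A) x"
    if P: "real_distribution P" and Q: "real_distribution Q" and x: "2 * A < x" for P Q A x
  proof -
    have "UNIV = (UNIV \<times> {-A..A} \<union> {-A..A} \<times> UNIV) \<union> ?out A" by auto
    then have "local_prob c (P \<star> Q) x = joint_mass c P Q ((UNIV \<times> {-A..A} \<union> {-A..A} \<times> UNIV) \<union> ?out A) x"
      using joint_mass_UNIV[OF P Q, of c x] by simp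
    also have "\<dots> = joint_mass c P Q (UNIV \<times> {-A..A} \<union> {-A..A} \<times> UNIV) x + joint_mass c P Q (?out A) x"
      by (rule joint_mass_Un[OF P Q _ out_sets]) auto
    also have "joint_mass c P Q (UNIV \<times> {-A..A} \<union> {-A..A} \<times> UNIV) x =
        joint_mass c P Q (UNIV \<times> {-A..A}) x + joint_mass c P Q ({-A..A} \<times> UNIV) x"
      using x by (intro joint_mass_Un[OF P Q]) auto
    finally show ?thesis by (simp add: joint_mass_fst[OF P Q] joint_mass_snd[OF P Q])
  qed
  have dens: "local_prob c P y \<le> K * ?f y" if "\<And>B. measure P B \<le> K * measure F B" for P K y
    using that by (simp add: local_prob_def)
  \<comment> \<open>The error caused by a summand in the window, and by dropping summands outside it.\<close>
  have near: "\<bar>(\<integral>s. indicator {-A..A} s * local_prob c P (x - s) \<partial>Q) / ?f x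
      - smear Q (\<lambda>x. local_prob c P x / ?f x) x\<bar> \<le> K * ?err Q A x + K * (1 - measure Q {-A..A})"
    if P: "real_distribution P" and Q: "real_distribution Q" and K: "0 \<le> K"
      and PK: "\<And>B. measure P B \<le> K * measure F B" and fx: "0 < ?f x" for P Q K A x
  proof -
    interpret real_distribution Q by fact
    let ?p = "local_prob c P" and ?W = "{-A..A}"
    have [measurable]: "?f \<in> borel_measurable borel" "?p \<in> borel_measurable borel"
      using F P c by auto
    have pK: "?p y \<le> K * ?f y" for y by (rule dens[OF PK])
    have p0: "0 \<le> ?p y" for y by (rule local_prob_bounds(1)[OF P])
    have r: "0 \<le> ?p y / ?f y" "?p y / ?f y \<le> K" "?p y = ?p y / ?f y * ?f y" for y
      using p0[of y] pK[of y] f0[of y] K by (cases "?f y = 0", auto simp: divide_simps)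
    have int: "integrable Q (\<lambda>s. indicator ?W s * ?p (x - s) / ?f x)"
      by (rule integrable_const_bound[where B = "1 / ?f x"])
        (use local_prob_bounds[OF P] fx in \<open>auto simp: indicator_def divide_right_mono\<close>)
    have int2: "integrable Q (\<lambda>s. ?p (x - s) / ?f (x - s))"
      by (rule integrable_const_bound[where B = K]) (use r(1,2) in \<open>auto simp del: abs_divide\<close>)
    have int3: "integrable Q (\<lambda>s. indicator ?W s * \<bar>?f (x - s) / ?f x - 1\<bar>)"
    proof (rule integrable_const_bound[where B = "1 / ?f x + 1"])
      have "\<bar>?f (x - s) / ?f x - 1\<bar> \<le> 1 / ?f x + 1" for s
      proof -
        have "0 \<le> ?f (x - s) / ?f x" "?f (x - s) / ?f x \<le> 1 / ?f x"
          using local_prob_bounds[OF F, of c "x - s"] fx by (auto simp: divide_right_mono)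
        then show ?thesis by linarith
      qed
      then show "AE s in Q. norm (indicator ?W s * \<bar>?f (x - s) / ?f x - 1\<bar>) \<le> 1 / ?f x + 1"
        using fx by (intro AE_I2) (auto simp: indicator_def)
    qed simp
    have intW: "integrable Q (indicat_real (- ?W))"
      by (rule integrable_const_bound[where B = 1]) (auto simp: indicator_def)
    have "\<bar>(\<integral>s. indicator ?W s * ?p (x - s) \<partial>Q) / ?f x - smear Q (\<lambda>x. ?p x / ?f x) x\<bar> =
        \<bar>\<integral>s. indicator ?W s * ?p (x - s) / ?f x - ?p (x - s) / ?f (x - s) \<partial>Q\<bar>"
      using int int2 by (simp add: smear_def)
    also have "\<dots> \<le> (\<integral>s. \<bar>indicator ?W s * ?p (x - s) / ?f x - ?p (x - s) / ?f (x - s)\<bar> \<partial>Q)"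
      by (rule integral_abs_bound)
    also have "\<dots> \<le> (\<integral>s. K * (indicator ?W s * \<bar>?f (x - s) / ?f x - 1\<bar>) + K * indicator (- ?W) s \<partial>Q)"
    proof (rule integral_mono)
      show "integrable Q (\<lambda>s. \<bar>indicator ?W s * ?p (x - s) / ?f x - ?p (x - s) / ?f (x - s)\<bar>)"
        using int int2 by (intro integrable_abs Bochner_Integration.integrable_diff)
      show "integrable Q (\<lambda>s. K * (indicator ?W s * \<bar>?f (x - s) / ?f x - 1\<bar>) + K * indicator (- ?W) s)"
        using int3 intW by (intro Bochner_Integration.integrable_add integrable_mult_right)
      fix s
      let ?r = "?p (x - s) / ?f (x - s)"
      show "\<bar>indicator ?W s * ?p (x - s) / ?f x - ?r\<bar> \<le>
          K * (indicator ?W s * \<bar>?f (x - s) / ?f x - 1\<bar>) + K * indicator (- ?W) s"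
      proof (cases "s \<in> ?W")
        case True
        have "?p (x - s) / ?f x - ?r = ?r * (?f (x - s) / ?f x - 1)"
        proof -
          have "P / X - R = R * (Y / X - 1)" if "P = R * Y" for P R X Y :: real
            by (simp add: that algebra_simps)
          from this[OF r(3)] show ?thesis .
        qed
        then have "\<bar>?p (x - s) / ?f x - ?r\<bar> = ?r * \<bar>?f (x - s) / ?f x - 1\<bar>"
          using r(1) by (simp only: abs_mult abs_of_nonneg)
        also have "\<dots> \<le> K * \<bar>?f (x - s) / ?f x - 1\<bar>"
          by (intro mult_right_mono r) simp
        finally show ?thesis using True by simp
      next
        case False
        then show ?thesis using r(1,2)[of "x - s"] by simp
      qed
    qed
    also have "\<dots> = K * ?err Q A x + K * measure Q (- ?W)"
      using int3 intW by (subst Bochner_Integration.integral_add) (simp_all del: indicator_compl)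
    also have "measure Q (- ?W) = 1 - measure Q ?W"
      using prob_compl[of ?W] by (simp add: Compl_eq_Diff_UNIV)
    finally show ?thesis .
  qed
  define E where "E A x = C * ?err N A x + C * (1 - measure N {-A..A}) +
      (D * ?err M A x + D * (1 - measure M {-A..A})) +
      C * D * (joint_mass c F F (?out A) x / ?f x)" for A x
  define lim where "lim A = C * 0 + C * (1 - measure N {-A..A}) + (D * 0 + D * (1 - measure M {-A..A})) +
      C * D * (2 - 1 * measure F {-A..A} - 1 * measure F {-A..A})" for A
  \<comment> \<open>Two disjoint window events exhaust \<open>(F \<star> F)(x + \<Delta>)\<close> up to the outer event, so its limit is explicit.\<close>
  have outer: "((\<lambda>x. joint_mass c F F (?out A) x / ?f x) \<longlongrightarrow>
      2 - 1 * measure F {-A..A} - 1 * measure F {-A..A}) at_top" for A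
  proof -
    let ?I = "\<lambda>x. \<integral>s. indicator {-A..A} s * ?f (x - s) \<partial>F"
    have ff: "((\<lambda>x. ?f x / ?f x) \<longlongrightarrow> 1) at_top"
      using class_L_ratio[OF L, of 0] by simp
    have I: "((\<lambda>x. ?I x / ?f x) \<longlongrightarrow> 1 * measure F {-A..A}) at_top"
      by (rule window_smear_limit[OF F c L F local_prob_measurable[OF F c] ff])
    have "((\<lambda>x. local_prob c (F \<star> F) x / ?f x - ?I x / ?f x - ?I x / ?f x) \<longlongrightarrow>
        2 - 1 * measure F {-A..A} - 1 * measure F {-A..A}) at_top"
      by (intro tendsto_diff class_S_DeltaD(3)[OF c S] I)
    then show ?thesis
    proof (rule Lim_transform_eventually)
      show "\<forall>\<^sub>F x in at_top. local_prob c (F \<star> F) x / ?f x - ?I x / ?f x - ?I x / ?f x =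
          joint_mass c F F (?out A) x / ?f x"
        using eventually_gt_at_top[of "2 * A"]
        by eventually_elim (simp add: decomp[OF F F] diff_divide_distrib[symmetric])
    qed
  qed
  have E_lim: "(E A \<longlongrightarrow> lim A) at_top" for A
    unfolding E_def lim_def
    by (intro tendsto_add tendsto_mult tendsto_const outer window_translation_error[OF F c L] M N)
  have bound: "\<forall>\<^sub>F x in at_top. \<bar>?D x\<bar> \<le> E A x" for A
    using eventually_gt_at_top[of "2 * A"] class_L_pos[OF L]
  proof eventually_elim
    case (elim x)
    have "joint_mass c M N (?out A) x \<le> C * D * joint_mass c F F (?out A) x"
      unfolding joint_mass_def
      by (rule pair_measure_dominated[OF M N F C le joint_mass_sets[OF out_sets]])
    then have 1: "joint_mass c M N (?out A) x / ?f x \<le> C * D * (joint_mass c F F (?out A) x / ?f x)"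
      using elim by (simp add: divide_right_mono)
    have 2: "0 \<le> joint_mass c M N (?out A) x / ?f x"
      using elim by (simp add: joint_mass_def)
    show ?case
      using near[OF M N C(1) le(1) elim(2), of A] near[OF N M C(2) le(2) elim(2), of A] 1 2
      unfolding E_def decomp[OF M N elim(1)] add_divide_distrib by linarith
  qed
  have "(lim \<longlongrightarrow> C * 0 + C * (1 - 1) + (D * 0 + D * (1 - 1)) + C * D * (2 - 1 * 1 - 1 * 1)) at_top"
    unfolding lim_def by (intro tendsto_intros measure_window_tendsto M N F)
  then have lim0: "(lim \<longlongrightarrow> 0) at_top" by simp
  show ?thesis
  proof (rule tendstoI)
    fix e :: real assume "0 < e"
    from order_tendstoD(2)[OF lim0 this] obtain A where "lim A < e"
      using eventually_happens'[OF trivial_limit_at_top_linorder] by blast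
    from order_tendstoD(2)[OF E_lim this] bound[of A]
    show "\<forall>\<^sub>F x in at_top. dist (?D x) 0 < e"
      by eventually_elim (simp add: dist_real_def)
  qed
qed

section \<open>A Tauberian lemma for compound negative binomial smearing\<close>

text \<open>The quotient of the rising factorials decays like \<open>n powr (-a)\<close>, by the limit formula for the
  reciprocal Gamma function. Hence the tail of the series for parameter \<open>a\<close> is negligible
  against the series for \<open>2 a\<close>, whose local probabilities are known from subexponentiality.\<close>

lemma neg_binomial_weight_ratio_tendsto_0:
  assumes a: "0 < a" and q: "0 < q" "q < 1"
  shows "(\<lambda>n. neg_binomial_weight a q n / neg_binomial_weight (a + a) q n) \<longlonglongrightarrow> 0"
proof -
  have nz: "rGamma (a + a) \<noteq> 0" using a by (auto simp: rGamma_eq_zero_iff elim!: nonpos_Ints_cases)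
  have "(\<lambda>n. rGamma_series a n / rGamma_series (a + a) n) \<longlonglongrightarrow> rGamma a / rGamma (a + a)"
    by (intro tendsto_intros nz)
  moreover have "(\<lambda>n. exp (- (a * ln (real n)))) \<longlonglongrightarrow> 0"
    by (intro filterlim_compose[OF exp_at_bot] filterlim_uminus_at_bot_at_top[THEN filterlim_compose]
        filterlim_tendsto_pos_mult_at_top[OF tendsto_const a] filterlim_compose[OF ln_at_top]
        filterlim_real_sequentially)
  ultimately have "(\<lambda>n. rGamma_series a n / rGamma_series (a + a) n * exp (- (a * ln (real n)))) \<longlonglongrightarrow>
      rGamma a / rGamma (a + a) * 0"
    by (rule tendsto_mult)
  moreover have "rGamma_series a n / rGamma_series (a + a) n * exp (- (a * ln (real n))) =
      pochhammer a (n + 1) / pochhammer (a + a) (n + 1)" for n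
  proof -
    define E where "E = exp (a * ln (real n))"
    have E: "E \<noteq> 0" "exp (- (a * ln (real n))) = inverse E"
      "exp ((a + a) * ln (real n)) = E * E"
      by (simp_all only: E_def distrib_right exp_add exp_minus exp_not_eq_zero not_False_eq_True)
    have "x / (y * E) / (z / (y * (E * E))) * inverse E = x / z" if "y \<noteq> 0" for x y z :: real
      using that E(1) by (simp add: divide_simps)
    from this[of "fact n"] show ?thesis
      unfolding rGamma_series_def E of_real_eq_id id_def E_def[symmetric] by simp
  qed
  ultimately have "(\<lambda>n. pochhammer a (n + 1) / pochhammer (a + a) (n + 1)) \<longlonglongrightarrow> 0"
    by simp
  then have "(\<lambda>n. pochhammer a n / pochhammer (a + a) n) \<longlonglongrightarrow> 0"
    by (simp add: LIMSEQ_imp_Suc)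
  from tendsto_mult_left[OF this, of "(1 - q) powr a / (1 - q) powr (a + a)"]
  show ?thesis
    using a q by (simp add: neg_binomial_weight_pochhammer mult.commute)
qed

lemma smear_return_0: "h \<in> borel_measurable borel \<Longrightarrow> smear (return borel 0) h x = h x"
  by (simp add: smear_def integral_return)

lemma smear_commute:
  assumes "real_distribution M" "real_distribution N"
    and "h \<in> borel_measurable borel" and "\<And>x. \<bar>h x\<bar> \<le> C"
  shows "smear M (smear N h) x = smear N (smear M h) x"
proof -
  have "(M \<star> N) = (N \<star> M)"
    by (rule convolution_commutative) (simp_all add: assms real_distribution_facts)
  then show ?thesis
    using smear_smear[OF assms(1,2,3,4)] smear_smear[OF assms(2,1,3,4)] by simp
qed

text \<open>For \<open>a = 1\<close> the compound distribution \<open>F\<close> is geometric and solves the renewal equation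
  \<open>F = (1 - q) \<delta> + q G \<star> F\<close>.\<close>

lemma smear_geometric:
  assumes G: "real_distribution G" and q: "0 < q" "q < 1"
    and h [measurable]: "h \<in> borel_measurable borel" and b: "\<And>x. \<bar>h x\<bar> \<le> C"
  shows "smear (compound_neg_binomial 1 q G) h x =
    (1 - q) * h x + q * smear G (smear (compound_neg_binomial 1 q G) h) x"
proof -
  let ?F = "compound_neg_binomial 1 q G"
  note F = real_distribution_compound_neg_binomial[OF G zero_less_one q]
  have w: "neg_binomial_weight 1 q n = (1 - q) * q ^ n" for n
    using q by (simp add: neg_binomial_weight_pochhammer pochhammer_fact[symmetric])
  have "(\<lambda>n. neg_binomial_weight 1 q n * smear (conv_power G n) h x) sums smear ?F h x"
    by (rule smear_compound_sums[OF G zero_less_one q h b])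
  then have "(\<lambda>n. neg_binomial_weight 1 q (Suc n) * smear (conv_power G (Suc n)) h x) sums
      (smear ?F h x - (1 - q) * h x)"
    by (subst sums_Suc_iff) (simp add: w smear_return_0)
  moreover have "(\<lambda>n. q * (neg_binomial_weight 1 q n * smear (conv_power G n) (smear G h) x)) sums
      (q * smear ?F (smear G h) x)"
    by (intro sums_mult smear_compound_sums[OF G zero_less_one q _ smear_bounded[OF G h b]])
      (rule smear_measurable[OF G h])
  moreover have "q * (neg_binomial_weight 1 q n * smear (conv_power G n) (smear G h) x) =
      neg_binomial_weight 1 q (Suc n) * smear (conv_power G (Suc n)) h x" for n
    using smear_smear[OF G real_distribution_conv_power[OF G] h b, of n] by (simp add: w)
  ultimately have "smear ?F h x - (1 - q) * h x = q * smear ?F (smear G h) x"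
    using sums_unique2 by simp
  also have "\<dots> = q * smear G (smear ?F h) x"
    using smear_commute[OF F G h b] by simp
  finally show ?thesis by simp
qed

text \<open>The renewal equation expresses \<open>h\<close> through two functions that both tend to \<open>k\<close>.\<close>

lemma geometric_tauberian:
  assumes G: "real_distribution G" and q: "0 < q" "q < 1"
    and h [measurable]: "h \<in> borel_measurable borel" and b: "\<And>x. \<bar>h x\<bar> \<le> C"
    and lim: "(smear (compound_neg_binomial 1 q G) h \<longlongrightarrow> k) at_top"
  shows "(h \<longlongrightarrow> k) at_top"
proof -
  let ?F = "compound_neg_binomial 1 q G"
  note F = real_distribution_compound_neg_binomial[OF G zero_less_one q]
  have "((\<lambda>x. (smear ?F h x - q * smear G (smear ?F h) x) / (1 - q)) \<longlongrightarrow> (k - q * k) / (1 - q)) at_top"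
    by (intro tendsto_intros lim
        smear_tendsto[OF G smear_measurable[OF F h] smear_bounded[OF F h b] lim]) (use q in simp)
  moreover have "(smear ?F h x - q * smear G (smear ?F h) x) / (1 - q) = h x" for x
    using smear_geometric[OF G q h b, of x] q by (simp add: field_simps)
  moreover have "(k - q * k) / (1 - q) = k" using q by (simp add: field_simps)
  ultimately show ?thesis by simp
qed

text \<open>Smearing with a compound negative binomial distribution can be undone in the limit. By the
  semigroup property \<open>a\<close> may be increased to an integer \<open>m\<close>, and the distribution with parameter \<open>m\<close>
  is an \<open>m\<close>-fold convolution of the geometric one, which is removed factor by factor.\<close>

lemma compound_tauberian:
  assumes G: "real_distribution G" and a: "0 < a" and q: "0 < q" "q < 1"
    and h [measurable]: "h \<in> borel_measurable borel" and b: "\<And>x. \<bar>h x\<bar> \<le> C"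
    and lim: "(smear (compound_neg_binomial a q G) h \<longlongrightarrow> k) at_top"
  shows "(h \<longlongrightarrow> k) at_top"
proof -
  let ?F = "\<lambda>a. compound_neg_binomial a q G"
  have F: "real_distribution (?F a)" if "0 < a" for a
    by (rule real_distribution_compound_neg_binomial[OF G that q])
  have integer: "(smear (?F (real (Suc m))) h \<longlongrightarrow> k) at_top \<Longrightarrow> (h \<longlongrightarrow> k) at_top" for m
  proof (induction m)
    case 0
    then show ?case using geometric_tauberian[OF G q h b] by simp
  next
    case (Suc m)
    have m: "0 < real (Suc m)" by simp
    have "smear (?F 1) (smear (?F (real (Suc m))) h) x = smear (?F (real (Suc (Suc m)))) h x" for x
      using smear_smear[OF F[OF m] F[OF zero_less_one] h b, of x]
        compound_convolution[OF G m zero_less_one q] by (simp add: add.commute)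
    then have "smear (?F 1) (smear (?F (real (Suc m))) h) = smear (?F (real (Suc (Suc m)))) h"
      by blast
    then have "(smear (?F (real (Suc m))) h \<longlongrightarrow> k) at_top"
      using Suc.prems by (intro geometric_tauberian[OF G q smear_measurable[OF F[OF m] h]
            smear_bounded[OF F[OF m] h b]]) simp
    then show ?case by (rule Suc.IH)
  qed
  \<comment> \<open>A strict inequality, so that the parameter \<open>real m - a\<close> is admissible.\<close>
  obtain m where m: "a < real m" using reals_Archimedean2 by blast
  then have "0 < m" using a by (cases m) auto
  then obtain m' where m': "m = Suc m'" by (cases m) auto
  have d: "0 < real m - a" using m by simp
  have "smear (?F (real m - a)) (smear (?F a) h) x = smear (?F (real (Suc m'))) h x" for x
    using smear_smear[OF F[OF a] F[OF d] h b, of x] compound_convolution[OF G a d q] by (simp add: m')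
  then have "smear (?F (real m - a)) (smear (?F a) h) = smear (?F (real (Suc m'))) h" by blast
  moreover have "(smear (?F (real m - a)) (smear (?F a) h) \<longlongrightarrow> k) at_top"
    by (rule smear_tendsto[OF F[OF d] smear_measurable[OF F[OF a] h] smear_bounded[OF F[OF a] h b] lim])
  ultimately show ?thesis using integer[of m'] by simp
qed

section \<open>From the compound distribution to the summand\<close>

lemma sums_tail_le:
  fixes u v :: "nat \<Rightarrow> real"
  assumes u: "u sums U" and v: "v sums V" and le: "\<And>n. N \<le> n \<Longrightarrow> u n \<le> \<rho> * v n"
  shows "U - (\<Sum>n<N. u n) \<le> \<rho> * (V - (\<Sum>n<N. v n))"
proof -
  have 1: "(\<lambda>n. u (n + N)) sums (U - (\<Sum>n<N. u n))"
    using u by (subst sums_iff_shift) simp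
  have 2: "(\<lambda>n. \<rho> * v (n + N)) sums (\<rho> * (V - (\<Sum>n<N. v n)))"
    using v by (intro sums_mult, subst sums_iff_shift) simp
  show ?thesis
    by (rule sums_le[OF _ 1 2]) (simp add: le)
qed

locale subexponential_compound =
  fixes c a q :: real and G :: "real measure"
  assumes c: "0 < c" and a: "0 < a" and q: "0 < q" "q < 1"
    and G: "real_distribution G"
    and S: "compound_neg_binomial a q G \<in> class_S_Delta c"
begin

definition F :: "real measure" where "F = compound_neg_binomial a q G"

text \<open>As every \<open>conv_power G n\<close> is dominated by a multiple of \<open>F\<close>, the numerator vanishes wherever the
  denominator does, and the convention \<open>0 / 0 = 0\<close> keeps the ratio bounded on the whole line.\<close>

definition local_prob_ratio :: "nat \<Rightarrow> real \<Rightarrow> real" where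
  "local_prob_ratio n x = local_prob c (conv_power G n) x / local_prob c F x"

lemma SF: "F \<in> class_S_Delta c" and F: "real_distribution F" and L: "local_prob c F \<in> class_L"
  using S class_S_DeltaD[OF c S] by (simp_all add: F_def)

lemma conv_power_le: "measure (conv_power G n) A \<le> 1 / neg_binomial_weight a q n * measure F A"
  unfolding F_def by (rule conv_power_le_compound[OF G a q])

lemma local_prob_ratio_bounds:
  "0 \<le> local_prob_ratio n x" "local_prob_ratio n x \<le> 1 / neg_binomial_weight a q n"
  "\<bar>local_prob_ratio n x\<bar> \<le> 1 / neg_binomial_weight a q n"
proof -
  note p = local_prob_bounds(1)[OF real_distribution_conv_power[OF G], of c n x]
  note f = local_prob_bounds(1)[OF F, of c x]
  show 0: "0 \<le> local_prob_ratio n x" using p f by (simp add: local_prob_ratio_def)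
  show 1: "local_prob_ratio n x \<le> 1 / neg_binomial_weight a q n"
  proof (cases "local_prob c F x = 0")
    case True
    then show ?thesis
      using neg_binomial_weight_nonneg[OF a q] by (simp add: local_prob_ratio_def)
  next
    case False
    then have "0 < local_prob c F x" using f by simp
    then show ?thesis
      using conv_power_le[of n "{x<..x + c}"] by (simp add: local_prob_ratio_def local_prob_def pos_divide_le_eq)
  qed
  show "\<bar>local_prob_ratio n x\<bar> \<le> 1 / neg_binomial_weight a q n" using 0 1 by simp
qed

lemma local_prob_ratio_measurable [measurable]: "local_prob_ratio n \<in> borel_measurable borel"
proof -
  have [measurable]: "local_prob c F \<in> borel_measurable borel"
    "local_prob c (conv_power G n) \<in> borel_measurable borel"
    using F real_distribution_conv_power[OF G] c by auto
  show ?thesis unfolding local_prob_ratio_def [abs_def] by measurable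
qed

text \<open>The power rule for the derivation, with \<open>conv_power G (n - 1)\<close> in the role of the power of
  degree \<open>n - 1\<close>.\<close>

lemma conv_power_derivation:
  "((\<lambda>x. local_prob_ratio n x - real n * smear (conv_power G (n - 1)) (local_prob_ratio 1) x) \<longlongrightarrow> 0) at_top"
proof (induction n)
  case 0
  have "\<forall>\<^sub>F x in at_top. 0 = local_prob_ratio 0 x"
    using eventually_ge_at_top[of 0]
    by eventually_elim (simp add: local_prob_ratio_def local_prob_def measure_return)
  from Lim_transform_eventually[OF tendsto_const this] show ?case by simp
next
  case (Suc n)
  note Gn = real_distribution_conv_power[OF G]
  let ?r = "local_prob_ratio 1"
  let ?d = "\<lambda>x. local_prob_ratio n x - real n * smear (conv_power G (n - 1)) ?r x"
  let ?C = "1 / neg_binomial_weight a q n + real n * (1 / neg_binomial_weight a q 1)"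
  have w: "0 \<le> 1 / neg_binomial_weight a q k" for k
    using neg_binomial_weight_nonneg[OF a q] by simp
  have sm: "smear (conv_power G k) ?r \<in> borel_measurable borel" for k
    by (rule smear_measurable[OF Gn local_prob_ratio_measurable])
  note sb = smear_bounded[OF Gn local_prob_ratio_measurable local_prob_ratio_bounds(3)]
  have [measurable]: "?d \<in> borel_measurable borel"
    using sm by measurable
  have db: "\<bar>?d x\<bar> \<le> ?C" for x
  proof -
    have "\<bar>?d x\<bar> \<le> \<bar>local_prob_ratio n x\<bar> + real n * \<bar>smear (conv_power G (n - 1)) ?r x\<bar>"
      using abs_triangle_ineq4[of "local_prob_ratio n x" "real n * smear (conv_power G (n - 1)) ?r x"]
      by (simp add: abs_mult)
    also have "\<dots> \<le> ?C"
      by (intro add_mono mult_left_mono local_prob_ratio_bounds sb) simp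
    finally show ?thesis .
  qed
  have d0: "(smear G ?d \<longlongrightarrow> 0) at_top"
    by (rule smear_tendsto[OF G _ db Suc]) measurable
  have G1: "conv_power G 1 = G" by (rule conv_power_1[OF G])
  have lin: "smear G (local_prob_ratio n) x = smear G ?d x + real n * smear (conv_power G n) ?r x" for x
  proof -
    have "smear G (local_prob_ratio n) x = smear G (\<lambda>x. ?d x + real n * smear (conv_power G (n - 1)) ?r x) x"
      by (rule arg_cong[where f = "\<lambda>h. smear G h x"]) auto
    also have "\<dots> = smear G ?d x + real n * smear G (smear (conv_power G (n - 1)) ?r) x"
    proof -
      have 1: "integrable G (\<lambda>s. ?d (x - s))"
        by (rule integrable_translate_bounded[OF G _ db]) measurable
      have 2: "integrable G (\<lambda>s. smear (conv_power G (n - 1)) ?r (x - s))"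
        by (rule integrable_translate_bounded[OF G sm sb])
      show ?thesis
        using Bochner_Integration.integral_add[OF 1 integrable_mult_right[OF 2, of "real n"]]
        unfolding smear_def [of G] by (simp only: integral_mult_right_zero)
    qed
    also have "real n * smear G (smear (conv_power G (n - 1)) ?r) x = real n * smear (conv_power G n) ?r x"
    proof (cases n)
      case (Suc m)
      have "(conv_power G m \<star> G) = conv_power G (Suc m)"
        using conv_power_add[OF G, of m 1] G1 by simp
      then show ?thesis
        using smear_smear[OF Gn G local_prob_ratio_measurable local_prob_ratio_bounds(3), of m 1 x] Suc by simp
    qed simp
    finally show ?thesis .
  qed
  have "((\<lambda>x. local_prob c (G \<star> conv_power G n) x / local_prob c F x
      - smear (conv_power G n) (\<lambda>x. local_prob c G x / local_prob c F x) x
      - smear G (\<lambda>x. local_prob c (conv_power G n) x / local_prob c F x) x) \<longlongrightarrow> 0) at_top"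
    by (rule convolution_derivation[OF c SF G Gn w w conv_power_le[of 1, unfolded G1] conv_power_le])
  then have "((\<lambda>x. local_prob_ratio (Suc n) x - smear (conv_power G n) ?r x - smear G (local_prob_ratio n) x) \<longlongrightarrow> 0) at_top"
    by (simp only: local_prob_ratio_def [abs_def] G1 conv_power.simps)
  from tendsto_add[OF this d0] show ?case
    by (simp add: lin algebra_simps)
qed

text \<open>Summing the power rule with the weights gives a chain rule. Its left-hand side is \<open>1\<close>, since the
  series is that of \<open>F\<close> itself; its right-hand side is the ratio for \<open>G\<close>, smeared with the
  compound distribution of parameter \<open>a + 1\<close>, as \<open>n\<close> times the \<open>n\<close>-th weight is a multiple of the preceding
  weight for \<open>a + 1\<close>. The Tauberian lemma removes the smearing. The tails of the two series are
  uniformly small: the first by comparison with \<open>F \<star> F\<close>, the second because the ratio is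
  bounded and the mean of the weights is finite.\<close>

lemma ratio_limit:
  "((\<lambda>x. local_prob c G x / local_prob c F x) \<longlongrightarrow> (1 - q) / (a * q)) at_top"
proof -
  let ?r = "local_prob_ratio 1"
  let ?w = "neg_binomial_weight a q" and ?w2 = "neg_binomial_weight (a + a) q"
  let ?k = "a * q / (1 - q)"
  let ?C = "1 / ?w 1"
  let ?s = "\<lambda>n x. smear (conv_power G (n - 1)) ?r x"
  let ?F1 = "compound_neg_binomial (a + 1) q G"
  have a1: "0 < a + 1" and a2: "0 < a + a" using a by auto
  note Gn = real_distribution_conv_power[OF G]
  have w: "0 \<le> ?w n" and w2: "0 < ?w2 n" for n
    using neg_binomial_weight_nonneg[OF a q] neg_binomial_weight_pos[OF a2 q] by auto
  have sb: "?s n x \<le> ?C" for n x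
    using smear_bounded[OF Gn local_prob_ratio_measurable local_prob_ratio_bounds(3), of "n - 1" 1 x] by linarith
  have s0: "0 \<le> ?s n x" for n x
    unfolding smear_def by (intro integral_nonneg_AE AE_I2 local_prob_ratio_bounds)
  have series: "(\<lambda>n. real n * ?w n * ?s n x) sums (?k * smear ?F1 ?r x)" for x
  proof -
    have "(\<lambda>n. ?k * (neg_binomial_weight (a + 1) q n * smear (conv_power G n) ?r x)) sums (?k * smear ?F1 ?r x)"
      by (intro sums_mult smear_compound_sums[OF G a1 q local_prob_ratio_measurable local_prob_ratio_bounds(3)])
    then have "(\<lambda>n. real (Suc n) * ?w (Suc n) * ?s (Suc n) x) sums (?k * smear ?F1 ?r x)"
      unfolding neg_binomial_weight_Suc[OF a q] by (simp add: mult.assoc)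
    from sums_Suc[OF this] show ?thesis by simp
  qed
  have "((\<lambda>x. 1 - ?k * smear ?F1 ?r x) \<longlongrightarrow> 0) at_top"
  proof (rule tendstoI)
    fix e :: real assume e: "0 < e"
    \<comment> \<open>The tail is at most \<open>e / 12\<close> times the ratio for \<open>F \<star> F\<close>, which is eventually below \<open>3\<close>.\<close>
    have "\<forall>\<^sub>F n in sequentially. ?w n / ?w2 n < e / 12"
      using neg_binomial_weight_ratio_tendsto_0[OF a q] by (rule order_tendstoD) (use e in simp)
    then obtain N1 where N1: "\<And>n. N1 \<le> n \<Longrightarrow> ?w n / ?w2 n < e / 12"
      unfolding eventually_sequentially by blast
    have "(\<lambda>N. ?C * (?k - (\<Sum>n<N. real n * ?w n))) \<longlonglongrightarrow> ?C * (?k - ?k)"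
      using neg_binomial_mean[OF a q] unfolding sums_def by (intro tendsto_intros)
    then have "\<forall>\<^sub>F N in sequentially. ?C * (?k - (\<Sum>n<N. real n * ?w n)) < e / 4"
      by (rule order_tendstoD) (use e in simp)
    with eventually_ge_at_top[of N1]
    have "\<forall>\<^sub>F N in sequentially. N1 \<le> N \<and> ?C * (?k - (\<Sum>n<N. real n * ?w n)) < e / 4"
      by (rule eventually_conj)
    then obtain N where N: "N1 \<le> N" "?C * (?k - (\<Sum>n<N. real n * ?w n)) < e / 4"
      using eventually_happens'[OF trivial_limit_sequentially] by blast
    have "((\<lambda>x. \<Sum>n<N. ?w n * (local_prob_ratio n x - real n * ?s n x)) \<longlongrightarrow> (\<Sum>n<N. ?w n * 0)) at_top"
      by (intro tendsto_sum tendsto_mult tendsto_const conv_power_derivation)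
    then have "((\<lambda>x. \<bar>\<Sum>n<N. ?w n * (local_prob_ratio n x - real n * ?s n x)\<bar>) \<longlongrightarrow> 0) at_top"
      using tendsto_rabs_zero by fastforce
    then have "\<forall>\<^sub>F x in at_top. \<bar>\<Sum>n<N. ?w n * (local_prob_ratio n x - real n * ?s n x)\<bar> < e / 4"
      by (rule order_tendstoD) (use e in simp)
    moreover have "\<forall>\<^sub>F x in at_top. local_prob c (F \<star> F) x / local_prob c F x < 3"
      using class_S_DeltaD(3)[OF c SF] by (rule order_tendstoD) simp
    ultimately show "\<forall>\<^sub>F x in at_top. dist (1 - ?k * smear ?F1 ?r x) 0 < e"
      using class_L_pos[OF L]
    proof eventually_elim
      case (elim x)
      let ?f = "local_prob c F x"
      have f: "0 < ?f" by fact
      have r0: "0 \<le> local_prob_ratio n x" for n by (rule local_prob_ratio_bounds)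
      have sums1: "(\<lambda>n. ?w n * local_prob_ratio n x) sums 1"
        using sums_divide[OF local_prob_compound_sums[OF G a q, of c x], of ?f] f
        by (simp add: local_prob_ratio_def F_def)
      have FF: "(F \<star> F) = compound_neg_binomial (a + a) q G"
        unfolding F_def by (rule compound_convolution[OF G a a q])
      have sums2: "(\<lambda>n. ?w2 n * local_prob_ratio n x) sums (local_prob c (F \<star> F) x / ?f)"
        unfolding FF
        using sums_divide[OF local_prob_compound_sums[OF G a2 q, of c x], of ?f]
        by (simp add: local_prob_ratio_def)
      have "1 - (\<Sum>n<N. ?w n * local_prob_ratio n x) \<le>
          e / 12 * (local_prob c (F \<star> F) x / ?f - (\<Sum>n<N. ?w2 n * local_prob_ratio n x))"
      proof (rule sums_tail_le[OF sums1 sums2])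
        fix n assume "N \<le> n"
        then have "?w n / ?w2 n \<le> e / 12" using N(1) N1[of n] by simp
        then have "?w n \<le> e / 12 * ?w2 n" using w2[of n] by (simp only: pos_divide_le_eq)
        then have "?w n * local_prob_ratio n x \<le> (e / 12 * ?w2 n) * local_prob_ratio n x"
          using r0 by (rule mult_right_mono)
        then show "?w n * local_prob_ratio n x \<le> e / 12 * (?w2 n * local_prob_ratio n x)"
          by (simp add: mult.assoc)
      qed
      also have "\<dots> \<le> e / 12 * 3"
      proof (rule mult_left_mono)
        have "0 \<le> (\<Sum>n<N. ?w2 n * local_prob_ratio n x)"
          using w2 r0 by (intro sum_nonneg mult_nonneg_nonneg) (auto intro: less_imp_le)
        then show "local_prob c (F \<star> F) x / ?f - (\<Sum>n<N. ?w2 n * local_prob_ratio n x) \<le> 3"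
          using elim by linarith
      qed (use e in simp)
      finally have A1: "1 - (\<Sum>n<N. ?w n * local_prob_ratio n x) \<le> e / 4" by simp
      have A0: "0 \<le> 1 - (\<Sum>n<N. ?w n * local_prob_ratio n x)"
        using sum_le_suminf[OF sums_summable[OF sums1], of "{..<N}"] sums_unique[OF sums1] w r0 by simp
      have B1: "?k * smear ?F1 ?r x - (\<Sum>n<N. real n * ?w n * ?s n x) \<le>
          ?C * (?k - (\<Sum>n<N. real n * ?w n))"
      proof (rule sums_tail_le[OF series neg_binomial_mean[OF a q]])
        show "real n * ?w n * ?s n x \<le> ?C * (real n * ?w n)" for n
          using mult_left_mono[OF sb[of n x], of "real n * ?w n"] w[of n]
          by (simp add: mult.commute)
      qed
      have B0: "0 \<le> ?k * smear ?F1 ?r x - (\<Sum>n<N. real n * ?w n * ?s n x)"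
        using sum_le_suminf[OF sums_summable[OF series[of x]], of "{..<N}"] sums_unique[OF series[of x]] w s0
        by simp
      have "(\<Sum>n<N. ?w n * (local_prob_ratio n x - real n * ?s n x)) =
          (\<Sum>n<N. ?w n * local_prob_ratio n x) - (\<Sum>n<N. real n * ?w n * ?s n x)"
        by (simp add: sum_subtractf[symmetric] algebra_simps)
      then show ?case
        using A0 A1 B0 B1 N(2) elim(1) e unfolding dist_real_def by linarith
    qed
  qed
  then have "((\<lambda>x. (1 - (1 - ?k * smear ?F1 ?r x)) / ?k) \<longlongrightarrow> (1 - 0) / ?k) at_top"
    by (intro tendsto_intros) (use a q in auto)
  moreover have "(1 - (1 - ?k * y)) / ?k = y" for y using a q by simp
  ultimately have "(smear ?F1 ?r \<longlongrightarrow> (1 - q) / (a * q)) at_top"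
    by simp
  from compound_tauberian[OF G a1 q local_prob_ratio_measurable local_prob_ratio_bounds(3) this]
  show ?thesis
    unfolding local_prob_ratio_def [abs_def] conv_power_1[OF G] .
qed

lemma class_S_Delta_summand: "G \<in> class_S_Delta c"
proof -
  let ?k = "(1 - q) / (a * q)"
  let ?r = "\<lambda>x. local_prob c G x / local_prob c F x"
  have k: "0 < ?k" using a q by simp
  have LG: "local_prob c G \<in> class_L"
    by (rule class_L_transfer[OF L _ _ ratio_limit k]) (use G c local_prob_bounds in auto)
  have G1: "conv_power G 1 = G" by (rule conv_power_1[OF G])
  have "(smear G (local_prob_ratio 1) \<longlongrightarrow> ?k) at_top"
    by (rule smear_tendsto[OF G local_prob_ratio_measurable local_prob_ratio_bounds(3)])
      (use ratio_limit in \<open>simp only: local_prob_ratio_def [abs_def] G1\<close>)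
  then have "((\<lambda>x. (local_prob_ratio 2 x - real 2 * smear (conv_power G (2 - 1)) (local_prob_ratio 1) x) +
      real 2 * smear G (local_prob_ratio 1) x) \<longlongrightarrow> 0 + real 2 * ?k) at_top"
    by (intro tendsto_intros conv_power_derivation)
  then have "(local_prob_ratio 2 \<longlongrightarrow> 2 * ?k) at_top"
    using G1 by simp
  then have "((\<lambda>x. local_prob_ratio 2 x / ?r x) \<longlongrightarrow> 2 * ?k / ?k) at_top"
    by (intro tendsto_divide ratio_limit) (use k in auto)
  moreover have "2 * ?k / ?k = 2"
    using k by (metis nonzero_mult_div_cancel_right less_irrefl)
  ultimately have "((\<lambda>x. local_prob_ratio 2 x / ?r x) \<longlongrightarrow> 2) at_top"
    by (simp only:)
  then have "((\<lambda>x. local_prob c (G \<star> G) x / local_prob c G x) \<longlongrightarrow> 2) at_top"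
    by (rule Lim_transform_eventually)
      (use class_L_pos[OF L] in \<open>eventually_elim, simp add: local_prob_ratio_def conv_power_2[OF G]\<close>)
  then show ?thesis by (rule class_S_DeltaI[OF G LG])
qed

end

section \<open>The equivalences\<close>

lemma almost_decreasing_transfer:
  assumes f: "almost_decreasing f" and L: "f \<in> class_L" and h: "\<And>x. 0 \<le> h x"
    and lim: "((\<lambda>x. h x / f x) \<longlongrightarrow> k) at_top" and k: "0 < k"
  shows "almost_decreasing h"
proof -
  obtain x0 K where K: "0 < x0" "0 < K" "\<And>x y. x0 < x \<Longrightarrow> 0 < y \<Longrightarrow> f (x + y) \<le> K * f x"
    using f unfolding almost_decreasing_def by blast
  have "\<forall>\<^sub>F x in at_top. h x / f x < 2 * k" "\<forall>\<^sub>F x in at_top. k / 2 < h x / f x"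
  proof -
    show "\<forall>\<^sub>F x in at_top. h x / f x < 2 * k"
      using lim by (rule order_tendstoD) (use k in simp)
    show "\<forall>\<^sub>F x in at_top. k / 2 < h x / f x"
      using lim by (rule order_tendstoD) (use k in simp)
  qed
  then have "\<forall>\<^sub>F x in at_top. h x \<le> 2 * k * f x \<and> k / 2 * f x \<le> h x"
    using class_L_pos[OF L] by eventually_elim (simp add: pos_divide_less_eq pos_less_divide_eq)
  then obtain x1 where x1: "\<And>x. x1 \<le> x \<Longrightarrow> h x \<le> 2 * k * f x \<and> k / 2 * f x \<le> h x"
    unfolding eventually_at_top_linorder by blast
  have "h (x + y) \<le> 4 * K * h x" if x: "max x0 x1 < x" and y: "0 < y" for x y
  proof -
    have "h (x + y) \<le> 2 * k * f (x + y)" using x1[of "x + y"] x y by simp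
    also have "\<dots> \<le> 2 * k * (K * f x)" using K(3)[of x y] x y k by simp
    also have "\<dots> = 4 * K * (k / 2 * f x)" by simp
    also have "\<dots> \<le> 4 * K * h x" using x1[of x] x K(2) by (intro mult_left_mono) auto
    finally show ?thesis .
  qed
  then show ?thesis
    using h K(1,2) unfolding almost_decreasing_def
    by (intro conjI allI exI[of _ "max x0 x1"] exI[of _ "4 * K"]) auto
qed

theorem theorem5p1:
  fixes c q a :: real and G Fa :: "real measure"
  assumes "0 < c" and "0 < q" and "q < 1" and "0 < a"
    and "real_distribution G"
  defines "Fa \<equiv> compound_neg_binomial a q G"
  shows "((Fa \<in> class_S_Delta c \<inter> class_D_Delta c \<longleftrightarrow> G \<in> class_S_Delta c \<inter> class_D_Delta c) \<and>
          (G \<in> class_S_Delta c \<inter> class_D_Delta c \<longleftrightarrow>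
             G \<in> class_L_Delta c \<inter> class_D_Delta c \<and>
             local_prob c Fa \<sim>[at_top] (\<lambda>x. a * q / (1 - q) * local_prob c G x))) \<and>
         (measure G {0..} = 1 \<longrightarrow>
           (Fa \<in> class_S_Delta c \<longleftrightarrow> G \<in> class_S_Delta c) \<and>
           (G \<in> class_S_Delta c \<longleftrightarrow>
             G \<in> class_L_Delta c \<and>
             local_prob c Fa \<sim>[at_top] (\<lambda>x. a * q / (1 - q) * local_prob c G x)))"
proof -
  note c = assms(1) and q = assms(2,3) and a = assms(4) and G = assms(5)
  have k: "0 < a * q / (1 - q)" using a q by simp
  have Fa: "real_distribution Fa"
    unfolding Fa_def by (rule real_distribution_compound_neg_binomial[OF G a q])
  have asymp: "local_prob c Fa \<sim>[at_top] (\<lambda>x. a * q / (1 - q) * local_prob c G x) \<longleftrightarrow>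
      ((\<lambda>x. local_prob c Fa x / local_prob c G x) \<longlongrightarrow> a * q / (1 - q)) at_top"
    if "local_prob c G \<in> class_L"
    by (rule asymp_equiv_cmult_iff[OF class_L_pos[OF that] k])
  have SL: "H \<in> class_L_Delta c" if "H \<in> class_S_Delta c" for H
    using that by (simp add: class_S_Delta_def)
  have LL: "local_prob c H \<in> class_L" if "H \<in> class_L_Delta c" for H
    using that by (simp add: class_L_Delta_def)
  have down: "G \<in> class_S_Delta c"
    "((\<lambda>x. local_prob c G x / local_prob c Fa x) \<longlongrightarrow> (1 - q) / (a * q)) at_top"
    if S: "Fa \<in> class_S_Delta c"
  proof -
    interpret P: subexponential_compound c a q G
      using c a q G S unfolding Fa_def by (rule subexponential_compound.intro)
    show "G \<in> class_S_Delta c" by (rule P.class_S_Delta_summand)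
    show "((\<lambda>x. local_prob c G x / local_prob c Fa x) \<longlongrightarrow> (1 - q) / (a * q)) at_top"
      using P.ratio_limit unfolding Fa_def P.F_def .
  qed
  have up: "Fa \<in> class_S_Delta c"
    "((\<lambda>x. local_prob c Fa x / local_prob c G x) \<longlongrightarrow> a * q / (1 - q)) at_top"
    if "G \<in> class_S_Delta c" "almost_decreasing (local_prob c G) \<or> measure G {0..} = 1"
    unfolding Fa_def
    by (rule class_S_Delta_compound[OF c a q that]) (rule compound_ratio[OF c a q that])
  have ratio_suffices: "G \<in> class_S_Delta c"
    if "G \<in> class_L_Delta c" "local_prob c Fa \<sim>[at_top] (\<lambda>x. a * q / (1 - q) * local_prob c G x)"
    using that(2) unfolding asymp[OF LL[OF that(1)]] unfolding Fa_def
    by (rule class_S_Delta_if_compound_ratio[OF c a q G LL[OF that(1)]])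
  have D: "Fa \<in> class_D_Delta c \<longleftrightarrow> almost_decreasing (local_prob c Fa)"
    "G \<in> class_D_Delta c \<longleftrightarrow> almost_decreasing (local_prob c G)"
    using Fa G by (simp_all add: class_D_Delta_def)
  have D_down: "almost_decreasing (local_prob c G)"
    if "Fa \<in> class_S_Delta c" "almost_decreasing (local_prob c Fa)"
    by (rule almost_decreasing_transfer[OF that(2) LL[OF SL[OF that(1)]] _ down(2)[OF that(1)]])
      (use a q local_prob_bounds(1)[OF G] in simp_all)
  have D_up: "almost_decreasing (local_prob c Fa)"
    if "G \<in> class_S_Delta c" "almost_decreasing (local_prob c G)"
    by (rule almost_decreasing_transfer[OF that(2) LL[OF SL[OF that(1)]] _ up(2)])
      (use that k local_prob_bounds(1)[OF Fa] in simp_all)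
  have forward: "G \<in> class_L_Delta c \<and> local_prob c Fa \<sim>[at_top] (\<lambda>x. a * q / (1 - q) * local_prob c G x)"
    if S: "G \<in> class_S_Delta c" and dom: "almost_decreasing (local_prob c G) \<or> measure G {0..} = 1"
    using asymp[OF LL[OF SL[OF S]]] up(2)[OF S dom] SL[OF S] by (simp only: simp_thms)
  show ?thesis
  proof (intro conjI impI iffI)
    assume "Fa \<in> class_S_Delta c \<inter> class_D_Delta c"
    then show "G \<in> class_S_Delta c \<inter> class_D_Delta c"
      using down(1) D_down by (simp add: D)
  next
    assume "G \<in> class_S_Delta c \<inter> class_D_Delta c"
    then show "Fa \<in> class_S_Delta c \<inter> class_D_Delta c"
      using up(1) D_up by (simp add: D)
  next
    assume "G \<in> class_S_Delta c \<inter> class_D_Delta c"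
    then have *: "G \<in> class_S_Delta c" "almost_decreasing (local_prob c G)" by (simp_all add: D)
    from forward[OF *(1) disjI1[OF *(2)]] *(2)
    show "G \<in> class_L_Delta c \<inter> class_D_Delta c"
      "local_prob c Fa \<sim>[at_top] (\<lambda>x. a * q / (1 - q) * local_prob c G x)"
      by (simp_all only: Int_iff D)
  next
    assume "G \<in> class_L_Delta c \<inter> class_D_Delta c \<and>
      local_prob c Fa \<sim>[at_top] (\<lambda>x. a * q / (1 - q) * local_prob c G x)"
    then show "G \<in> class_S_Delta c \<inter> class_D_Delta c"
      using ratio_suffices by (simp only: Int_iff)
  next
    assume "measure G {0..} = 1"
    note up' = up[OF _ disjI2[OF this]] and forward' = forward[OF _ disjI2[OF this]]
    show "Fa \<in> class_S_Delta c" if "G \<in> class_S_Delta c" by (rule up'(1)[OF that])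
    show "G \<in> class_L_Delta c" if "G \<in> class_S_Delta c" using forward'[OF that] ..
    show "local_prob c Fa \<sim>[at_top] (\<lambda>x. a * q / (1 - q) * local_prob c G x)"
      if "G \<in> class_S_Delta c" using forward'[OF that] ..
  next
    show "G \<in> class_S_Delta c" if "Fa \<in> class_S_Delta c" by (rule down(1)[OF that])
    show "G \<in> class_S_Delta c"
      if "G \<in> class_L_Delta c \<and> local_prob c Fa \<sim>[at_top] (\<lambda>x. a * q / (1 - q) * local_prob c G x)"
      using that ratio_suffices by blast
  qed
qed

end
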